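(* Suppose $X$ has an indefinite Wiener integral. Then the following are equivalent: (i) $X$ is not a martingale (with respect to its own filtration); (ii) for every $\mathfrak c\in\mathfrak H$ there is an $r\in[0,T]$ such that $D_r^{\mathfrak c}\subsetneqq L^2_X$.
   Context: Let $T>0$ and let $X=(X_t)_{t\in[0,T]}$ be a measurable centered Gaussian process with $X_0=0$ on a complete probability space $(\Omega,\mathcal F,P)$, with covariance $R(t,s)=\mathbb E[X_tX_s]$. Let $(\mathcal F^X_t)_{t\in[0,T]}$ be the filtration generated by $X$ and $L^2_X=L^2(\Omega,\mathcal F^X_T,P)$. The first chaos $H_X$ is the closure in $L^2_X$ of $\mathrm{span}\{X_s:0\le s\le T\}$. The space of deterministic integrands $\mathfrak H=\mathfrak H_X$ is the Hilbert space obtained as closure (completion) of the linear span of the indicator functions $\mathbf 1_{(0,t]}$, $t\in[0,T]$, with inner product $\langle \mathbf 1_{(0,t]},\mathbf 1_{(0,s]}\rangle_{\mathfrak H}=R(t,s)$. The Wiener integral $I:\mathfrak H\to H_X$ is the unique linear isometry with $I(\mathbf 1_{(0,t]})=X_t$. For $h\in H_X$, the Wick exponential is $e^{\diamond h}=\exp\{h-\frac12\mathbb E[h^2]\}$. The $S$-transform of $\xi\in L^2_X$ is $(S\xi)(\mathfrak h)=\mathbb E[\xi e^{\diamond I(\mathfrak h)}]$, $\mathfrak h\in\mathfrak H$; it determines $\xi$ uniquely. $X$ has an indefinite Wiener integral if for every $r\in[0,T]$ there is a continuous linear operator $\mathbb I_r:\mathfrak H\to\mathfrak H$ with $\mathbb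 I_r(\mathbf 1_{(0,t]})=\mathbf 1_{(0,t\wedge r]}$ for all $t\in[0,T]$. In this case $\mathbb I_r^*$ denotes the adjoint and $\mathfrak h^r:=\mathbb I_r^*\mathfrak h$ for $\mathfrak h\in\mathfrak H$. For $r\in[0,T]$ and $\mathfrak c\in\mathfrak H$, the domain of the $\mathfrak c$-shifted quasi-conditional expectation is $$D_r^{\mathfrak c}=\left\{\xi\in L^2_X:\ \exists\,\eta\in L^2_X\text{ such that }(S\xi)((\mathfrak h+\mathfrak c)^r-\mathfrak c)=(S\eta)(\mathfrak h)\ \ \forall\,\mathfrak h\in\mathfrak H\right\}.$$ *)

theory Defs
  imports "HOL-Probability.Probability"
begin

text \<open>
  Throughout, \<open>X :: real \<Rightarrow> 'a \<Rightarrow> real\<close> represents a process indexed by \<open>{0..T}\<close>; its values at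
  other times are never used. Elements of \<open>L\<^sup>2\<close> are represented by functions, so identities
  between random variables are stated almost everywhere.
\<close>

section \<open>Gaussian processes\<close>

text \<open>Constants count as Gaussian, with variance zero.\<close>

definition gaussian_rv :: "'a measure \<Rightarrow> ('a \<Rightarrow> real) \<Rightarrow> bool" where
  "gaussian_rv M Y \<longleftrightarrow> Y \<in> borel_measurable M \<and>
     (\<exists>\<mu>. (AE \<omega> in M. Y \<omega> = \<mu>) \<or> (\<exists>\<sigma>>0. distributed M lborel Y (normal_density \<mu> \<sigma>)))"

definition gaussian_process :: "'a measure \<Rightarrow> real \<Rightarrow> (real \<Rightarrow> 'a \<Rightarrow> real) \<Rightarrow> bool" where
  "gaussian_process M T X \<longleftrightarrow>
     (\<forall>A a. finite A \<and> A \<subseteq> {0..T} \<longrightarrow> gaussian_rv M (\<lambda>\<omega>. \<Sum>t\<in>A. a t * X t \<omega>))"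

definition centered_process :: "'a measure \<Rightarrow> real \<Rightarrow> (real \<Rightarrow> 'a \<Rightarrow> real) \<Rightarrow> bool" where
  "centered_process M T X \<longleftrightarrow> (\<forall>t\<in>{0..T}. (\<integral>\<omega>. X t \<omega> \<partial>M) = 0)"

definition measurable_process :: "'a measure \<Rightarrow> real \<Rightarrow> (real \<Rightarrow> 'a \<Rightarrow> real) \<Rightarrow> bool" where
  "measurable_process M T X \<longleftrightarrow>
     (\<lambda>(t, \<omega>). X t \<omega>) \<in> borel_measurable (restrict_space borel {0..T} \<Otimes>\<^sub>M M)"

definition covariance :: "'a measure \<Rightarrow> (real \<Rightarrow> 'a \<Rightarrow> real) \<Rightarrow> real \<Rightarrow> real \<Rightarrow> real" where
  "covariance M X t s = (\<integral>\<omega>. X t \<omega> * X s \<omega> \<partial>M)"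

definition generated_filtration :: "'a measure \<Rightarrow> (real \<Rightarrow> 'a \<Rightarrow> real) \<Rightarrow> real \<Rightarrow> 'a measure" where
  "generated_filtration M X t =
     sigma (space M) (\<Union>s\<in>{0..t}. {X s -` B \<inter> space M | B. B \<in> sets borel})"

text \<open>Adaptedness is automatic for the generated filtration.\<close>

definition own_martingale :: "'a measure \<Rightarrow> real \<Rightarrow> (real \<Rightarrow> 'a \<Rightarrow> real) \<Rightarrow> bool" where
  "own_martingale M T X \<longleftrightarrow>
     (\<forall>t\<in>{0..T}. integrable M (X t)) \<and>
     (\<forall>s t. 0 \<le> s \<and> s \<le> t \<and> t \<le> T \<longrightarrow>
        (AE \<omega> in M. real_cond_exp M (generated_filtration M X s) (X t) \<omega> = X s \<omega>))"

definition L2X :: "'a measure \<Rightarrow> real \<Rightarrow> (real \<Rightarrow> 'a \<Rightarrow> real) \<Rightarrow> ('a \<Rightarrow> real) set" where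
  "L2X M T X = {\<xi> \<in> borel_measurable (generated_filtration M X T). integrable M (\<lambda>\<omega>. (\<xi> \<omega>)\<^sup>2)}"

text \<open>The \<open>L\<^sup>2\<close>-closure of the span of the \<open>X\<^sub>t\<close>.\<close>

definition first_chaos :: "'a measure \<Rightarrow> real \<Rightarrow> (real \<Rightarrow> 'a \<Rightarrow> real) \<Rightarrow> ('a \<Rightarrow> real) set" where
  "first_chaos M T X = {\<xi> \<in> L2X M T X. \<forall>\<epsilon>>0. \<exists>A a. finite A \<and> A \<subseteq> {0..T} \<and>
     (\<integral>\<omega>. (\<xi> \<omega> - (\<Sum>t\<in>A. a t * X t \<omega>))\<^sup>2 \<partial>M) < \<epsilon>}"

section \<open>Deterministic integrands and the Wiener integral\<close>

definition ind :: "real \<Rightarrow> real \<Rightarrow> real" where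
  "ind t = indicator {0<..t}"

text \<open>
  The Hilbert space type \<open>'h\<close>, together with the canonical map \<open>\<iota>\<close>, is the completion of
  the span of the indicators of \<open>{0<..t}\<close>, \<open>t \<in> {0..T}\<close>, under the inner product that \<open>R\<close>
  determines on them: \<open>\<iota>\<close> is linear on this span, preserves the (possibly degenerate) inner
  product, and has dense range. This pins down \<open>'h\<close> and \<open>\<iota>\<close> up to a unique isometric isomorphism.
  Off the span, \<open>\<iota>\<close> is arbitrary.
\<close>

definition integrand_space ::
  "real \<Rightarrow> (real \<Rightarrow> real \<Rightarrow> real) \<Rightarrow> ((real \<Rightarrow> real) \<Rightarrow> 'h::{real_inner, complete_space}) \<Rightarrow> bool" where
  "integrand_space T R \<iota> \<longleftrightarrow>
     (\<forall>A a. finite A \<and> A \<subseteq> {0..T} \<longrightarrow>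
        \<iota> (\<lambda>x. \<Sum>t\<in>A. a t * ind t x) = (\<Sum>t\<in>A. a t *\<^sub>R \<iota> (ind t))) \<and>
     (\<forall>t\<in>{0..T}. \<forall>s\<in>{0..T}. inner (\<iota> (ind t)) (\<iota> (ind s)) = R t s) \<and>
     closure (span ((\<lambda>t. \<iota> (ind t)) ` {0..T})) = UNIV"

definition is_wiener_integral ::
  "'a measure \<Rightarrow> real \<Rightarrow> (real \<Rightarrow> 'a \<Rightarrow> real) \<Rightarrow> ((real \<Rightarrow> real) \<Rightarrow> 'h::{real_inner, complete_space}) \<Rightarrow>
   ('h \<Rightarrow> 'a \<Rightarrow> real) \<Rightarrow> bool" where
  "is_wiener_integral M T X \<iota> I \<longleftrightarrow>
     (\<forall>h. I h \<in> first_chaos M T X) \<and>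
     (\<forall>a b h k. AE \<omega> in M. I (a *\<^sub>R h + b *\<^sub>R k) \<omega> = a * I h \<omega> + b * I k \<omega>) \<and>
     (\<forall>h. (\<integral>\<omega>. (I h \<omega>)\<^sup>2 \<partial>M) = (norm h)\<^sup>2) \<and>
     (\<forall>t\<in>{0..T}. AE \<omega> in M. I (\<iota> (ind t)) \<omega> = X t \<omega>)"

text \<open>Unique up to null sets for each integrand, hence a choice of representatives.\<close>

definition wiener_integral ::
  "'a measure \<Rightarrow> real \<Rightarrow> (real \<Rightarrow> 'a \<Rightarrow> real) \<Rightarrow> ((real \<Rightarrow> real) \<Rightarrow> 'h::{real_inner, complete_space}) \<Rightarrow>
   'h \<Rightarrow> 'a \<Rightarrow> real" where
  "wiener_integral M T X \<iota> = (SOME I. is_wiener_integral M T X \<iota> I)"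

definition wick_exp :: "'a measure \<Rightarrow> ('a \<Rightarrow> real) \<Rightarrow> 'a \<Rightarrow> real" where
  "wick_exp M Y \<omega> = exp (Y \<omega> - (1/2) * (\<integral>\<omega>'. (Y \<omega>')\<^sup>2 \<partial>M))"

definition S_transform ::
  "'a measure \<Rightarrow> real \<Rightarrow> (real \<Rightarrow> 'a \<Rightarrow> real) \<Rightarrow> ((real \<Rightarrow> real) \<Rightarrow> 'h::{real_inner, complete_space}) \<Rightarrow>
   ('a \<Rightarrow> real) \<Rightarrow> 'h \<Rightarrow> real" where
  "S_transform M T X \<iota> \<xi> h = (\<integral>\<omega>. \<xi> \<omega> * wick_exp M (wiener_integral M T X \<iota> h) \<omega> \<partial>M)"

section \<open>Indefinite Wiener integrals and shifted quasi-conditional expectations\<close>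

definition is_restriction_op ::
  "real \<Rightarrow> ((real \<Rightarrow> real) \<Rightarrow> 'h::{real_inner, complete_space}) \<Rightarrow> real \<Rightarrow> ('h \<Rightarrow> 'h) \<Rightarrow> bool" where
  "is_restriction_op T \<iota> r A \<longleftrightarrow>
     bounded_linear A \<and> (\<forall>t\<in>{0..T}. A (\<iota> (ind t)) = \<iota> (ind (min t r)))"

definition has_indefinite_wiener_integral ::
  "real \<Rightarrow> ((real \<Rightarrow> real) \<Rightarrow> 'h::{real_inner, complete_space}) \<Rightarrow> bool" where
  "has_indefinite_wiener_integral T \<iota> \<longleftrightarrow> (\<forall>r\<in>{0..T}. \<exists>A. is_restriction_op T \<iota> r A)"

definition restriction_op ::
  "real \<Rightarrow> ((real \<Rightarrow> real) \<Rightarrow> 'h::{real_inner, complete_space}) \<Rightarrow> real \<Rightarrow> 'h \<Rightarrow> 'h" where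
  "restriction_op T \<iota> r = (THE A. is_restriction_op T \<iota> r A)"

definition stopped_integrand ::
  "real \<Rightarrow> ((real \<Rightarrow> real) \<Rightarrow> 'h::{real_inner, complete_space}) \<Rightarrow> real \<Rightarrow> 'h \<Rightarrow> 'h" where
  "stopped_integrand T \<iota> r h = adjoint (restriction_op T \<iota> r) h"

definition shifted_qce_domain ::
  "'a measure \<Rightarrow> real \<Rightarrow> (real \<Rightarrow> 'a \<Rightarrow> real) \<Rightarrow> ((real \<Rightarrow> real) \<Rightarrow> 'h::{real_inner, complete_space}) \<Rightarrow>
   real \<Rightarrow> 'h \<Rightarrow> ('a \<Rightarrow> real) set" where
  "shifted_qce_domain M T X \<iota> r c = {\<xi> \<in> L2X M T X. \<exists>\<eta> \<in> L2X M T X. \<forall>h.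
     S_transform M T X \<iota> \<xi> (stopped_integrand T \<iota> r (h + c) - c) = S_transform M T X \<iota> \<eta> h}"

end

theory Submission
  imports Defs
begin

text \<open>
  Write \<open>e\<^sub>t\<close> for the image of the indicator of \<open>(0,t]\<close> in the Hilbert space of integrands, \<open>I\<close> for
  the Wiener integral and \<open>A\<^sub>r\<close> for the restriction operator, \<open>A\<^sub>r e\<^sub>t = e\<^sub>t\<^sub>\<and>\<^sub>r\<close>. Both sides of the
  equivalence, negated, say that the increments \<open>e\<^sub>t - e\<^sub>s\<close> are orthogonal to \<open>e\<^sub>u\<close> for
  \<open>u \<le> s \<le> t\<close>, that is, that each \<open>A\<^sub>r\<close> is an orthogonal projection.

  Suppose that for some \<open>c\<close> every domain is all of \<open>L\<^sup>2\<close>. Then every \<open>A\<^sub>r\<close> is a contraction: given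
  \<open>g\<close>, take \<open>\<xi>\<close> in \<open>L\<^sup>2\<close> that dominates \<open>exp (n I g - n\<^sup>2 |g|\<^sup>2 - n)\<close> for all \<open>n\<close>
  (\<open>L2_dominating_exponentials\<close>). Its transform at \<open>k\<close> is at least \<open>exp (n \<langle>g,k\<rangle> - n\<^sup>2|g|\<^sup>2/2 - n)\<close>,
  whereas the transform of any \<open>\<eta>\<close> in \<open>L\<^sup>2\<close> at \<open>h\<close> is at most a constant times \<open>exp (|h|\<^sup>2/2)\<close>. If
  \<open>\<xi>\<close> lies in the domain, evaluating at \<open>h = n A\<^sub>r g\<close>, where \<open>\<langle>g, A\<^sub>r\<^sup>* h\<rangle> = n |A\<^sub>r g|\<^sup>2\<close>, and
  letting \<open>n\<close> grow forces \<open>|A\<^sub>r g| \<le> |g|\<close>; the shift \<open>c\<close> contributes only terms linear in \<open>n\<close>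
  (\<open>norm_le_of_transform_growth\<close>). As \<open>A\<^sub>s\<close> fixes \<open>e\<^sub>u\<close> and kills \<open>e\<^sub>t - e\<^sub>s\<close>, contractivity yields the
  orthogonality (\<open>orthogonal_of_contraction\<close>).

  Orthogonality is independence here: if \<open>q\<close> is orthogonal to all \<open>e\<^sub>s\<close> with \<open>s \<le> r\<close>, then \<open>I q\<close> is
  independent of the past up to \<open>r\<close> (\<open>expectation_mult_future\<close>), because the joint characteristic
  function factors. For \<open>q = e\<^sub>t - e\<^sub>s\<close> this makes \<open>X\<close> a martingale.

  Conversely let \<open>X\<close> be a martingale. Then \<open>A\<^sub>r\<close> is self-adjoint and idempotent, so \<open>h\<close> splits as
  \<open>p + q\<close> with \<open>p = A\<^sub>r h = h\<^sup>r\<close> and \<open>q\<close> orthogonal to the past. The Wick exponential of \<open>h\<close> is the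
  product of those of \<open>p\<close>, measurable at time \<open>r\<close>, and of \<open>q\<close>, independent of the past with mean
  one. Hence \<open>\<eta> = E[\<xi> | F\<^sub>r]\<close> has transform \<open>h \<mapsto> (S \<xi>)(h\<^sup>r)\<close>, and with \<open>c = 0\<close> all domains are all
  of \<open>L\<^sup>2\<close> (\<open>qce_domain_of_martingale\<close>).
\<close>

section \<open>Adjoints in Hilbert spaces\<close>

lemma quadratic_nonneg_linear_zero:
  fixes b c :: real
  assumes q: "\<And>x. 0 \<le> 2 * x * b + x\<^sup>2 * c" and c: "c \<ge> 0"
  shows "b = 0"
proof (cases "c = 0")
  case True
  then have "b * b \<le> 0" using q[of "- b"] by simp
  then show ?thesis by (metis mult_eq_0_iff order_antisym zero_le_square)
next
  case False
  then have pos: "c > 0" using c by simp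
  \<comment> \<open>the minimum of the quadratic\<close>
  have "2 * (- b / c) * b + (- b / c)\<^sup>2 * c = - (b\<^sup>2 / c)"
    using pos by (simp add: power2_eq_square field_simps)
  then have "b\<^sup>2 / c \<le> 0" using q[of "- b / c"] by linarith
  then show ?thesis using pos by (simp add: divide_le_0_iff)
qed

text \<open>
  The representing vector minimises \<open>\<langle>v,v\<rangle> - 2 l v\<close>. By the parallelogram law a minimising
  sequence is Cauchy, and the first variation at the minimum is \<open>\<langle>w,x\<rangle> - l x\<close>.
\<close>

lemma riesz_representation:
  fixes l :: "'h::{real_inner, complete_space} \<Rightarrow> real"
  assumes l: "bounded_linear l"
  shows "\<exists>w. \<forall>x. l x = inner w x"
proof -
  interpret bounded_linear l by fact
  define J where "J v = inner v v - 2 * l v" for v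
  obtain K where K: "\<And>v. \<bar>l v\<bar> \<le> norm v * K"
    using bounded by auto
  have J_lower: "- K\<^sup>2 \<le> J v" for v
  proof -
    have "0 \<le> (norm v - K)\<^sup>2" by simp
    then show ?thesis
      using K[of v] by (simp add: J_def power2_norm_eq_inner[symmetric] power2_diff algebra_simps)
  qed
  define m where "m = Inf (range J)"
  have bdd: "bdd_below (range J)"
    using J_lower by (intro bdd_belowI[of _ "- K\<^sup>2"]) auto
  have m_le: "m \<le> J v" for v
    unfolding m_def using bdd by (intro cInf_lower) auto
  have "\<exists>v. J v < m + 1 / Suc n" for n
  proof -
    have "\<exists>x\<in>range J. x < m + 1 / Suc n"
      unfolding m_def by (subst cInf_less_iff[symmetric]) (use bdd in auto)
    then show ?thesis by auto
  qed
  then obtain v where v: "\<And>n. J (v n) < m + 1 / Suc n" by metis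
  \<comment> \<open>parallelogram law\<close>
  have gap: "(norm (x - y))\<^sup>2 \<le> 2 * (J x - m) + 2 * (J y - m)" for x y
  proof -
    have "(norm (x - y))\<^sup>2 = 2 * J x + 2 * J y - 4 * J ((1/2) *\<^sub>R (x + y))"
      by (simp add: J_def power2_norm_eq_inner inner_simps inner_commute add diff scaleR
        algebra_simps)
    then show ?thesis using m_le[of "(1/2) *\<^sub>R (x + y)"] by simp
  qed
  have "Cauchy v"
  proof (rule metric_CauchyI)
    fix e :: real assume "e > 0"
    then obtain N where N: "4 / e\<^sup>2 < real N" using reals_Archimedean2 by blast
    show "\<exists>M. \<forall>p\<ge>M. \<forall>n\<ge>M. dist (v p) (v n) < e"
    proof (intro exI allI impI)
      fix p n assume pn: "N \<le> p" "N \<le> n"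
      have *: "1 / Suc k < e\<^sup>2 / 4" if "N \<le> k" for k
      proof -
        have "4 / e\<^sup>2 < Suc k" using N that by linarith
        then show ?thesis using \<open>e > 0\<close> by (simp add: field_simps)
      qed
      have "(norm (v p - v n))\<^sup>2 \<le> 2 * (J (v p) - m) + 2 * (J (v n) - m)" by (rule gap)
      also have "\<dots> < 2 * (1 / Suc p) + 2 * (1 / Suc n)" using v[of p] v[of n] by simp
      also have "\<dots> < e\<^sup>2" using *[OF pn(1)] *[OF pn(2)] by simp
      finally show "dist (v p) (v n) < e"
        using \<open>e > 0\<close> by (simp add: dist_norm power_less_imp_less_base)
    qed
  qed
  then obtain w where w: "v \<longlonglongrightarrow> w" using Cauchy_convergent convergent_def by blast
  have "(\<lambda>n. J (v n)) \<longlonglongrightarrow> J w"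
    unfolding J_def by (intro tendsto_intros w tendsto)
  moreover have "(\<lambda>n. m + 1 / Suc n) \<longlonglongrightarrow> m + 0"
    by (intro tendsto_intros LIMSEQ_inverse_real_of_nat[unfolded inverse_eq_divide])
  ultimately have "J w \<le> m + 0"
    using v by (intro LIMSEQ_le[of "\<lambda>n. J (v n)"]) (auto intro: less_imp_le)
  then have Jw: "J w \<le> J u" for u using m_le[of u] by simp
  have "l x = inner w x" for x
  proof -
    define b where "b = inner w x - l x"
    have q: "0 \<le> 2 * t * b + t\<^sup>2 * inner x x" for t
      using Jw[of "w + t *\<^sub>R x"]
      by (simp add: J_def b_def inner_simps add scaleR inner_commute power2_eq_square algebra_simps)
    have "b = 0" by (rule quadratic_nonneg_linear_zero[OF q]) simp
    then show ?thesis by (simp add: b_def)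
  qed
  then show ?thesis by blast
qed

text \<open>
  \<open>adjoint\<close> is defined by choice, so it is meaningful only once an adjoint is known to exist; the
  Riesz theorem supplies one outside finite dimension.
\<close>

lemma adjoint_works_hilbert:
  fixes A :: "'h::{real_inner, complete_space} \<Rightarrow> 'k::real_inner"
  assumes A: "bounded_linear A"
  shows "inner x (adjoint A y) = inner (A x) y"
proof -
  have "\<exists>w. \<forall>x. inner (A x) y = inner w x" for y
    by (rule riesz_representation)
       (rule bounded_linear_compose[OF bounded_linear_inner_left A])
  then obtain B where B: "\<And>x y. inner (A x) y = inner (B y) x" by metis
  then have "adjoint A = B"
    by (intro adjoint_unique) (simp add: inner_commute)
  then show ?thesis using B[of x y] by (simp add: inner_commute)
qed

section \<open>Square-integrable random variables\<close>

lemma L2_mult_integrable: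
  fixes f g :: "'a \<Rightarrow> real"
  assumes [measurable]: "f \<in> borel_measurable M" "g \<in> borel_measurable M"
    and f: "integrable M (\<lambda>x. (f x)\<^sup>2)" and g: "integrable M (\<lambda>x. (g x)\<^sup>2)"
  shows "integrable M (\<lambda>x. f x * g x)"
proof (rule Bochner_Integration.integrable_bound[OF Bochner_Integration.integrable_add[OF f g]])
  have "\<bar>a * b\<bar> \<le> \<bar>a\<^sup>2 + b\<^sup>2\<bar>" for a b :: real
  proof -
    have "0 \<le> (\<bar>a\<bar> - \<bar>b\<bar>)\<^sup>2" by simp
    then have "2 * \<bar>a * b\<bar> \<le> a\<^sup>2 + b\<^sup>2" by (simp add: power2_diff abs_mult algebra_simps)
    then show ?thesis by simp
  qed
  then show "AE x in M. norm (f x * g x) \<le> norm ((f x)\<^sup>2 + (g x)\<^sup>2)"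
    by simp
qed simp

lemma L2_lincomb_integrable:
  fixes f g :: "'a \<Rightarrow> real"
  assumes [measurable]: "f \<in> borel_measurable M" "g \<in> borel_measurable M"
    and f: "integrable M (\<lambda>x. (f x)\<^sup>2)" and g: "integrable M (\<lambda>x. (g x)\<^sup>2)"
  shows "integrable M (\<lambda>x. (a * f x + b * g x)\<^sup>2)"
    and "(\<integral>x. (a * f x + b * g x)\<^sup>2 \<partial>M)
       = a\<^sup>2 * (\<integral>x. (f x)\<^sup>2 \<partial>M) + 2 * a * b * (\<integral>x. f x * g x \<partial>M) + b\<^sup>2 * (\<integral>x. (g x)\<^sup>2 \<partial>M)"
proof -
  have eq: "(\<lambda>x. (a * f x + b * g x)\<^sup>2)
      = (\<lambda>x. a\<^sup>2 * (f x)\<^sup>2 + 2 * a * b * (f x * g x) + b\<^sup>2 * (g x)\<^sup>2)"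
    by (auto simp: fun_eq_iff power2_eq_square algebra_simps)
  note fg = L2_mult_integrable[OF assms]
  show "integrable M (\<lambda>x. (a * f x + b * g x)\<^sup>2)"
    unfolding eq using f g fg by (intro Bochner_Integration.integrable_add integrable_mult_right) auto
  show "(\<integral>x. (a * f x + b * g x)\<^sup>2 \<partial>M)
       = a\<^sup>2 * (\<integral>x. (f x)\<^sup>2 \<partial>M) + 2 * a * b * (\<integral>x. f x * g x \<partial>M) + b\<^sup>2 * (\<integral>x. (g x)\<^sup>2 \<partial>M)"
    unfolding eq using f g fg by simp
qed

lemma L2_cauchy_schwarz:
  fixes f g :: "'a \<Rightarrow> real"
  assumes [measurable]: "f \<in> borel_measurable M" "g \<in> borel_measurable M"
    and f: "integrable M (\<lambda>x. (f x)\<^sup>2)" and g: "integrable M (\<lambda>x. (g x)\<^sup>2)"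
  shows "(\<integral>x. f x * g x \<partial>M)\<^sup>2 \<le> (\<integral>x. (f x)\<^sup>2 \<partial>M) * (\<integral>x. (g x)\<^sup>2 \<partial>M)"
proof -
  define F G C where "F = (\<integral>x. (f x)\<^sup>2 \<partial>M)" and "G = (\<integral>x. (g x)\<^sup>2 \<partial>M)"
    and "C = (\<integral>x. f x * g x \<partial>M)"
  \<comment> \<open>the square of \<open>G f - C g\<close> has nonnegative integral; this avoids dividing by \<open>G\<close>\<close>
  have q: "0 \<le> G\<^sup>2 * F - 2 * G * C * C + C\<^sup>2 * G"
  proof -
    have "0 \<le> (\<integral>x. (G * f x + (- C) * g x)\<^sup>2 \<partial>M)" by simp
    also have "\<dots> = G\<^sup>2 * F + 2 * G * (- C) * C + (- C)\<^sup>2 * G"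
      unfolding F_def G_def C_def by (rule L2_lincomb_integrable(2)[OF assms])
    finally show ?thesis by simp
  qed
  have "G \<ge> 0" unfolding G_def by simp
  show ?thesis
  proof (cases "G = 0")
    case True
    then have "AE x in M. (g x)\<^sup>2 = 0"
      unfolding G_def using g by (subst (asm) integral_nonneg_eq_0_iff_AE) auto
    then have "C = (\<integral>x. 0 \<partial>M)"
      unfolding C_def by (intro integral_cong_AE) auto
    then show ?thesis using True by (simp add: C_def F_def G_def)
  next
    case False
    then have "G > 0" using \<open>G \<ge> 0\<close> by simp
    moreover have "0 \<le> G * (G * F - C\<^sup>2)" using q by (simp add: power2_eq_square algebra_simps)
    ultimately have "C\<^sup>2 \<le> F * G" by (simp add: zero_le_mult_iff mult.commute)
    then show ?thesis by (simp add: C_def F_def G_def)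
  qed
qed

lemma (in prob_space) L1_le_L2:
  fixes f :: "'a \<Rightarrow> real"
  assumes [measurable]: "f \<in> borel_measurable M" and f: "integrable M (\<lambda>x. (f x)\<^sup>2)"
  shows "integrable M f" and "(\<integral>x. \<bar>f x\<bar> \<partial>M)\<^sup>2 \<le> (\<integral>x. (f x)\<^sup>2 \<partial>M)"
proof -
  show "integrable M f" using L2_mult_integrable[of f M "\<lambda>_. 1"] f by simp
  show "(\<integral>x. \<bar>f x\<bar> \<partial>M)\<^sup>2 \<le> (\<integral>x. (f x)\<^sup>2 \<partial>M)"
    using L2_cauchy_schwarz[of "\<lambda>x. \<bar>f x\<bar>" M "\<lambda>_. 1"] f by (simp add: prob_space)
qed

text \<open>
  A geometric rate makes the telescoping series converge almost everywhere, so the limit can be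
  taken pointwise and inherits measurability with respect to the sub-\<open>\<sigma>\<close>-algebra. Fatou's lemma
  carries the rate over to the limit.
\<close>

lemma (in prob_space) L2_complete:
  fixes f :: "nat \<Rightarrow> 'a \<Rightarrow> real"
  assumes sub: "subalgebra M G"
    and meas: "\<And>n. f n \<in> borel_measurable G"
    and int: "\<And>n m. n \<le> m \<Longrightarrow> integrable M (\<lambda>x. (f m x - f n x)\<^sup>2)"
    and cauchy: "\<And>n m. n \<le> m \<Longrightarrow> (\<integral>x. (f m x - f n x)\<^sup>2 \<partial>M) \<le> (1/4) ^ n"
  obtains F where "F \<in> borel_measurable G"
    and "\<And>n. integrable M (\<lambda>x. (F x - f n x)\<^sup>2)"
    and "\<And>n. (\<integral>x. (F x - f n x)\<^sup>2 \<partial>M) \<le> (1/4) ^ n"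
proof -
  have [measurable]: "f n \<in> borel_measurable M" for n
    using measurable_from_subalg[OF sub meas] .
  define d where "d n x = \<bar>f (Suc n) x - f n x\<bar>" for n x
  have [measurable]: "d n \<in> borel_measurable M" for n unfolding d_def by simp
  have d_int: "integrable M (d n)" and d_le: "(\<integral>x. d n x \<partial>M) \<le> (1/2) ^ n" for n
  proof -
    have i: "integrable M (\<lambda>x. (d n x)\<^sup>2)" using int[of n "Suc n"] by (simp add: d_def)
    show "integrable M (d n)" using L1_le_L2(1)[OF _ i] by simp
    have "(\<integral>x. \<bar>d n x\<bar> \<partial>M)\<^sup>2 \<le> (\<integral>x. (d n x)\<^sup>2 \<partial>M)" using L1_le_L2(2)[OF _ i] by simp
    also have "\<dots> \<le> (1/4) ^ n" using cauchy[of n "Suc n"] by (simp add: d_def)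
    also have "\<dots> = ((1/2) ^ n)\<^sup>2" by (simp add: power2_eq_square power_mult_distrib[symmetric])
    finally have "\<bar>\<integral>x. \<bar>d n x\<bar> \<partial>M\<bar> \<le> (1/2) ^ n" by (simp add: abs_le_square_iff[symmetric])
    then show "(\<integral>x. d n x \<partial>M) \<le> (1/2) ^ n" by (simp add: d_def)
  qed
  have "(\<integral>\<^sup>+x. (\<Sum>n. ennreal (d n x)) \<partial>M) = (\<Sum>n. \<integral>\<^sup>+x. ennreal (d n x) \<partial>M)"
    by (rule nn_integral_suminf) simp
  also have "\<dots> = (\<Sum>n. ennreal (\<integral>x. d n x \<partial>M))"
    by (subst nn_integral_eq_integral[OF d_int]) (auto simp: d_def)
  also have "\<dots> \<le> (\<Sum>n. ennreal ((1/2) ^ n))"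
    using d_le by (intro suminf_le) (auto intro: ennreal_leI)
  also have "\<dots> = ennreal (\<Sum>n. (1/2) ^ n)"
    by (intro suminf_ennreal2) (auto intro: summable_geometric)
  also have "\<dots> < \<infinity>" by simp
  finally have "AE x in M. (\<Sum>n. ennreal (d n x)) \<noteq> \<infinity>"
    by (intro nn_integral_PInf_AE) (auto simp: less_top)
  then have conv: "AE x in M. (\<lambda>n. f n x) \<longlonglongrightarrow> lim (\<lambda>n. f n x)"
  proof eventually_elim
    case (elim x)
    have "summable (\<lambda>n. d n x)"
      using elim by (intro summable_suminf_not_top) (auto simp: d_def)
    then have "summable (\<lambda>n. f (Suc n) x - f n x)"
      unfolding d_def by (rule summable_rabs_cancel)
    then have "convergent (\<lambda>n. f n x - f 0 x)"
      unfolding summable_iff_convergent sum_lessThan_telescope[of "\<lambda>n. f n x"] .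
    then obtain L where "(\<lambda>n. f n x - f 0 x) \<longlonglongrightarrow> L" by (auto simp: convergent_def)
    from tendsto_add[OF this tendsto_const[of "f 0 x"]]
    have "convergent (\<lambda>n. f n x)" by (auto simp: convergent_def)
    then show ?case by (simp add: convergent_LIMSEQ_iff)
  qed
  define F where "F x = lim (\<lambda>n. f n x)" for x
  have F: "F \<in> borel_measurable G" unfolding F_def using meas by (intro borel_measurable_lim_metric)
  then have [measurable]: "F \<in> borel_measurable M" by (rule measurable_from_subalg[OF sub])
  have bound: "(\<integral>\<^sup>+x. ennreal ((F x - f n x)\<^sup>2) \<partial>M) \<le> ennreal ((1/4) ^ n)" for n
  proof -
    have "(\<integral>\<^sup>+x. ennreal ((F x - f n x)\<^sup>2) \<partial>M)
        = (\<integral>\<^sup>+x. liminf (\<lambda>m. ennreal ((f m x - f n x)\<^sup>2)) \<partial>M)"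
    proof (rule nn_integral_cong_AE)
      show "AE x in M. ennreal ((F x - f n x)\<^sup>2) = liminf (\<lambda>m. ennreal ((f m x - f n x)\<^sup>2))"
        using conv
      proof eventually_elim
        case (elim x)
        then have "(\<lambda>m. ennreal ((f m x - f n x)\<^sup>2)) \<longlonglongrightarrow> ennreal ((F x - f n x)\<^sup>2)"
          unfolding F_def by (intro tendsto_intros elim tendsto_ennrealI)
        then show ?case by (intro lim_imp_Liminf[symmetric]) auto
      qed
    qed
    also have "\<dots> \<le> liminf (\<lambda>m. \<integral>\<^sup>+x. ennreal ((f m x - f n x)\<^sup>2) \<partial>M)"
      by (rule nn_integral_liminf) simp
    also have "\<dots> \<le> liminf (\<lambda>m. ennreal ((1/4) ^ n))"
    proof (rule Liminf_mono)
      show "eventually (\<lambda>m. (\<integral>\<^sup>+x. ennreal ((f m x - f n x)\<^sup>2) \<partial>M) \<le> ennreal ((1/4) ^ n)) sequentially"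
        using eventually_ge_at_top[of n]
      proof eventually_elim
        case (elim m)
        show ?case
          by (subst nn_integral_eq_integral[OF int[OF elim]]) (use cauchy[OF elim] in \<open>auto intro: ennreal_leI\<close>)
      qed
    qed
    also have "\<dots> = ennreal ((1/4) ^ n)" by (simp add: Liminf_const)
    finally show ?thesis .
  qed
  have i: "integrable M (\<lambda>x. (F x - f n x)\<^sup>2)" for n
    using bound[of n] by (intro integrableI_bounded) (auto simp: order_le_less_trans)
  have "(\<integral>x. (F x - f n x)\<^sup>2 \<partial>M) \<le> (1/4) ^ n" for n
    using bound[of n] by (subst (asm) nn_integral_eq_integral[OF i]) auto
  then show ?thesis using that F i by blast
qed

section \<open>Independence from Fourier transforms\<close>

text \<open>
  Since \<open>g\<close> is bounded and has mean zero (\<open>\<theta> = 0\<close>), a multiple of it perturbs \<open>M\<close> to another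
  probability measure with density \<open>1 + g/K'\<close>. Under both measures \<open>Y\<close> has the same characteristic
  function, hence the same law, by Levy's uniqueness theorem.
\<close>

lemma (in prob_space) fourier_zero_real:
  fixes g Y :: "'a \<Rightarrow> real"
  assumes [measurable]: "g \<in> borel_measurable M" "Y \<in> borel_measurable M" "B \<in> sets borel"
    and bound: "\<And>x. \<bar>g x\<bar> \<le> K"
    and zero: "\<And>\<theta>. (CLINT x|M. g x * iexp (\<theta> * Y x)) = 0"
  shows "(\<integral>x. g x * indicator B (Y x) \<partial>M) = 0"
proof -
  \<comment> \<open>strictly positive even if \<open>K = 0\<close>\<close>
  define K' where "K' = \<bar>K\<bar> + 1"
  have K': "K' > 0" "\<And>x. \<bar>g x\<bar> \<le> K'"
    unfolding K'_def using bound by (auto simp: add_increasing2 intro!: order_trans[OF bound])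
  define p where "p x = 1 + g x / K'" for x
  have [measurable]: "p \<in> borel_measurable M" unfolding p_def by simp
  have p_nonneg: "p x \<ge> 0" for x
    using K'(2)[of x] K'(1) by (simp add: p_def field_simps abs_le_iff)
  have p_le: "p x \<le> 2" for x
    using K'(2)[of x] K'(1) by (simp add: p_def field_simps abs_le_iff)
  have g_int: "integrable M g"
    by (rule integrable_const_bound[of _ K]) (use bound in auto)
  have p_int: "integrable M p"
    by (rule integrable_const_bound[of _ 2]) (use p_nonneg p_le in auto)
  have "complex_of_real (\<integral>x. g x \<partial>M) = 0" using zero[of 0] by (simp add: integral_complex_of_real)
  then have Eg: "(\<integral>x. g x \<partial>M) = 0" by simp
  then have Ep: "(\<integral>x. p x \<partial>M) = 1"
    unfolding p_def using g_int by (simp add: prob_space)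
  define N where "N = density M (\<lambda>x. ennreal (p x))"
  have N: "prob_space N"
  proof
    have "emeasure N (space N) = (\<integral>\<^sup>+x. ennreal (p x) \<partial>M)"
      unfolding N_def by (simp add: emeasure_density nn_integral_set_ennreal[symmetric] cong: nn_integral_cong_simp)
    also have "\<dots> = 1"
      using Ep by (subst nn_integral_eq_integral[OF p_int]) (auto simp: p_nonneg)
    finally show "emeasure N (space N) = 1" .
  qed
  have YN: "Y \<in> borel_measurable N" unfolding N_def by simp
  have "distr N borel Y = distr M borel Y"
  proof (rule Levy_uniqueness)
    show "real_distribution (distr N borel Y)"
      using prob_space.real_distribution_distr[OF N YN] .
    show "real_distribution (distr M borel Y)" by simp
    show "char (distr N borel Y) = char (distr M borel Y)"
    proof
      fix \<theta>
      have e_int: "integrable M (\<lambda>x. iexp (\<theta> * Y x))"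
        by (rule integrable_const_bound[of _ 1]) auto
      have ge_int: "integrable M (\<lambda>x. g x * iexp (\<theta> * Y x))"
        by (rule integrable_const_bound[of _ K]) (use bound in \<open>auto simp: norm_mult\<close>)
      have "char (distr N borel Y) \<theta> = (CLINT x|N. iexp (\<theta> * Y x))"
        unfolding char_def by (subst integral_distr[OF YN]) auto
      also have "\<dots> = (CLINT x|M. p x *\<^sub>R iexp (\<theta> * Y x))"
        unfolding N_def by (subst integral_density) (auto simp: p_nonneg)
      also have "\<dots> = (CLINT x|M. iexp (\<theta> * Y x) + (1 / K') *\<^sub>R (g x * iexp (\<theta> * Y x)))"
        by (intro Bochner_Integration.integral_cong)
           (auto simp: p_def scaleR_conv_of_real algebra_simps)
      also have "\<dots> = (CLINT x|M. iexp (\<theta> * Y x))"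
        using e_int ge_int zero[of \<theta>] by simp
      also have "\<dots> = char (distr M borel Y) \<theta>"
        unfolding char_def by (subst integral_distr) auto
      finally show "char (distr N borel Y) \<theta> = char (distr M borel Y) \<theta>" .
    qed
  qed
  then have "(\<integral>x. indicator B (Y x) \<partial>N) = (\<integral>x. indicator B (Y x) \<partial>M :: real)"
    using integral_distr[OF YN, of "indicator B :: real \<Rightarrow> real"]
      integral_distr[of Y M borel "indicator B :: real \<Rightarrow> real"] by simp
  then have "(\<integral>x. p x * indicator B (Y x) \<partial>M) = (\<integral>x. indicator B (Y x) \<partial>M :: real)"
    unfolding N_def by (subst (asm) integral_density) (auto simp: p_nonneg)
  moreover have "(\<integral>x. p x * indicator B (Y x) \<partial>M)
      = (\<integral>x. indicator B (Y x) + (1 / K') * (g x * indicator B (Y x)) \<partial>M)"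
    by (intro Bochner_Integration.integral_cong) (auto simp: p_def algebra_simps)
  moreover have "\<dots> = (\<integral>x. indicator B (Y x) \<partial>M) + (1 / K') * (\<integral>x. g x * indicator B (Y x) \<partial>M)"
  proof -
    have "integrable M (\<lambda>x. indicator B (Y x) :: real)"
      by (rule integrable_const_bound[of _ 1]) auto
    moreover have "integrable M (\<lambda>x. g x * indicator B (Y x))"
      by (rule integrable_const_bound[of _ K])
         (use bound in \<open>auto simp: indicator_def intro: order_trans[OF abs_ge_zero]\<close>)
    ultimately show ?thesis by simp
  qed
  ultimately show ?thesis using K'(1) by simp
qed

text \<open>
  The hypothesis at \<open>- \<theta>\<close>, conjugated, gives the hypothesis for the conjugate of \<open>W\<close>, so it holds
  for the real and the imaginary part separately.
\<close>

lemma (in prob_space) fourier_zero_complex: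
  fixes W :: "'a \<Rightarrow> complex" and Y :: "'a \<Rightarrow> real"
  assumes [measurable]: "W \<in> borel_measurable M" "Y \<in> borel_measurable M" "B \<in> sets borel"
    and bound: "\<And>x. norm (W x) \<le> K"
    and zero: "\<And>\<theta>. (CLINT x|M. W x * iexp (\<theta> * Y x)) = 0"
  shows "(CLINT x|M. W x * indicator B (Y x)) = 0"
proof -
  have i: "integrable M (\<lambda>x. W x * iexp (\<theta> * Y x))" for \<theta>
    by (rule integrable_const_bound[of _ K]) (use bound in \<open>auto simp: norm_mult\<close>)
  have i': "integrable M (\<lambda>x. cnj (W x) * iexp (\<theta> * Y x))" for \<theta>
    using integrable_cnj[OF i[of "- \<theta>"]] by (simp add: exp_cnj)
  have cnj_zero: "(CLINT x|M. cnj (W x) * iexp (\<theta> * Y x)) = 0" for \<theta>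
  proof -
    have "(CLINT x|M. cnj (W x) * iexp (\<theta> * Y x)) = (CLINT x|M. cnj (W x * iexp ((- \<theta>) * Y x)))"
      by (intro Bochner_Integration.integral_cong) (auto simp: exp_cnj)
    also have "\<dots> = cnj (CLINT x|M. W x * iexp ((- \<theta>) * Y x))" by (rule Bochner_Integration.integral_cnj)
    finally show ?thesis using zero[of "- \<theta>"] by simp
  qed
  have "(CLINT x|M. Re (W x) * iexp (\<theta> * Y x)) = 0" for \<theta>
  proof -
    have Re_eq: "complex_of_real (Re w) = (1/2) * w + (1/2) * cnj w" for w
      by (simp add: complex_eq_iff)
    have "(CLINT x|M. Re (W x) * iexp (\<theta> * Y x))
        = (CLINT x|M. (1/2) * (W x * iexp (\<theta> * Y x)) + (1/2) * (cnj (W x) * iexp (\<theta> * Y x)))"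
      unfolding Re_eq by (simp only: distrib_right mult.assoc)
    also have "\<dots> = 0" using i[of \<theta>] i'[of \<theta>] zero[of \<theta>] cnj_zero[of \<theta>] by simp
    finally show ?thesis .
  qed
  then have re: "(\<integral>x. Re (W x) * indicator B (Y x) \<partial>M) = 0"
    by (intro fourier_zero_real[where K=K]) (auto intro: order_trans[OF abs_Re_le_cmod bound])
  have "(CLINT x|M. Im (W x) * iexp (\<theta> * Y x)) = 0" for \<theta>
  proof -
    have Im_eq: "complex_of_real (Im w) = (1/(2*\<i>)) * w - (1/(2*\<i>)) * cnj w" for w
      by (simp add: complex_eq_iff)
    have "(CLINT x|M. Im (W x) * iexp (\<theta> * Y x))
        = (CLINT x|M. (1/(2*\<i>)) * (W x * iexp (\<theta> * Y x)) - (1/(2*\<i>)) * (cnj (W x) * iexp (\<theta> * Y x)))"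
      unfolding Im_eq by (simp only: left_diff_distrib mult.assoc)
    also have "\<dots> = 0" using i[of \<theta>] i'[of \<theta>] zero[of \<theta>] cnj_zero[of \<theta>] by simp
    finally show ?thesis .
  qed
  then have im: "(\<integral>x. Im (W x) * indicator B (Y x) \<partial>M) = 0"
    by (intro fourier_zero_real[where K=K]) (auto intro: order_trans[OF abs_Im_le_cmod bound])
  have "integrable M (\<lambda>x. W x * indicator B (Y x))"
    by (rule integrable_const_bound[of _ K])
       (use bound in \<open>auto simp: norm_mult indicator_def intro: order_trans[OF norm_ge_zero]\<close>)
  moreover have "Re (W x * indicator B (Y x)) = Re (W x) * indicator B (Y x)"
    "Im (W x * indicator B (Y x)) = Im (W x) * indicator B (Y x)" for x
    by (auto simp: indicator_def)
  ultimately show ?thesis using re im by (intro complex_eqI) (auto simp flip: integral_Re integral_Im)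
qed

text \<open>
  A substitute for the uniqueness theorem of Fourier transforms in several dimensions: the
  exponentials in the single variables are traded for indicators one at a time, the remaining ones
  being absorbed into the weight \<open>W\<close>, which is why \<open>W\<close> is arbitrary in the induction.
\<close>

lemma (in prob_space) fourier_zero_family:
  fixes W :: "'a \<Rightarrow> complex" and Y :: "'j \<Rightarrow> 'a \<Rightarrow> real"
  assumes "finite J"
    and "W \<in> borel_measurable M" and "\<And>x. norm (W x) \<le> K"
    and [measurable]: "\<And>j. j \<in> J \<Longrightarrow> Y j \<in> borel_measurable M" "\<And>j. j \<in> J \<Longrightarrow> B j \<in> sets borel"
    and "\<And>\<theta>. (CLINT x|M. W x * iexp (\<Sum>j\<in>J. \<theta> j * Y j x)) = 0"
  shows "(CLINT x|M. W x * (\<Prod>j\<in>J. indicator (B j) (Y j x))) = 0"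
  using assms
proof (induction J arbitrary: W rule: finite_induct)
  case empty
  then show ?case by simp
next
  case (insert k J)
  note [measurable] = insert.prems(1)
  have [measurable]: "Y k \<in> borel_measurable M" "B k \<in> sets borel"
    "\<And>j. j \<in> J \<Longrightarrow> Y j \<in> borel_measurable M" using insert.prems by auto
  have "(CLINT x|M. (W x * indicator (B k) (Y k x)) * (\<Prod>j\<in>J. indicator (B j) (Y j x))) = 0"
  proof (rule insert.IH)
    show "(\<lambda>x. W x * indicator (B k) (Y k x)) \<in> borel_measurable M" by simp
    show "norm (W x * indicator (B k) (Y k x)) \<le> K" for x
      using insert.prems(2)[of x]
      by (auto simp: norm_mult indicator_def intro: order_trans[OF norm_ge_zero])
    show "(CLINT x|M. (W x * indicator (B k) (Y k x)) * iexp (\<Sum>j\<in>J. \<theta> j * Y j x)) = 0" for \<theta>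
    proof -
      have "(CLINT x|M. (W x * iexp (\<Sum>j\<in>J. \<theta> j * Y j x)) * indicator (B k) (Y k x)) = 0"
      proof (rule fourier_zero_complex[where K=K])
        show "(\<lambda>x. W x * iexp (\<Sum>j\<in>J. \<theta> j * Y j x)) \<in> borel_measurable M" by simp
        show "norm (W x * iexp (\<Sum>j\<in>J. \<theta> j * Y j x)) \<le> K" for x
          using insert.prems(2)[of x] by (simp add: norm_mult del: of_real_sum)
        fix s
        have z: "(CLINT x|M. W x * iexp (\<Sum>j\<in>insert k J. (\<theta>(k := s)) j * Y j x)) = 0"
          by (rule insert.prems(5))
        have "(\<Sum>j\<in>insert k J. (\<theta>(k := s)) j * Y j x) = s * Y k x + (\<Sum>j\<in>J. \<theta> j * Y j x)" for x
        proof -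
          have "(\<Sum>j\<in>J. (\<theta>(k := s)) j * Y j x) = (\<Sum>j\<in>J. \<theta> j * Y j x)"
            using insert.hyps(2) by (intro sum.cong) auto
          then show ?thesis using insert.hyps by simp
        qed
        with z show "(CLINT x|M. W x * iexp (\<Sum>j\<in>J. \<theta> j * Y j x) * iexp (s * Y k x)) = 0"
          by (simp add: exp_add distrib_left mult_ac del: of_real_sum)
      qed simp_all
      then show ?thesis by (simp add: mult_ac del: of_real_sum)
    qed
  qed (use insert.prems in auto)
  then show ?case using insert.hyps by (simp add: mult_ac)
qed

text \<open>
  The Fourier argument is used twice: with weight \<open>exp (i \<theta> U) - E exp (i \<theta> U)\<close> it replaces the
  exponentials in the \<open>X\<^sub>t\<close> by the indicator of a cylinder set \<open>A\<close>; with weight \<open>1\<^sub>A - P(A)\<close> it then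
  replaces \<open>exp (i \<theta> U)\<close> by the indicator of an event of \<open>U\<close>. Cylinder sets form an
  intersection-stable generator.
\<close>

lemma (in prob_space) indep_set_of_fourier:
  fixes X :: "'j \<Rightarrow> 'a \<Rightarrow> real" and U :: "'a \<Rightarrow> real"
  assumes meas: "\<And>t. t \<in> S \<Longrightarrow> X t \<in> borel_measurable M" and [measurable]: "U \<in> borel_measurable M"
    and factor: "\<And>J \<phi> \<theta>. finite J \<Longrightarrow> J \<subseteq> S \<Longrightarrow>
      (CLINT \<omega>|M. iexp (\<theta> * U \<omega>) * iexp (\<Sum>t\<in>J. \<phi> t * X t \<omega>))
        = (CLINT \<omega>|M. iexp (\<theta> * U \<omega>)) * (CLINT \<omega>|M. iexp (\<Sum>t\<in>J. \<phi> t * X t \<omega>))"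
  shows "indep_set (sigma_sets (space M) (\<Union>s\<in>S. {X s -` B \<inter> space M | B. B \<in> sets borel}))
    (sigma_sets (space M) {U -` B \<inter> space M | B. B \<in> sets borel})"
proof -
  define E where "E = {{\<omega>\<in>space M. \<forall>t\<in>J. X t \<omega> \<in> B t} | J B.
    finite J \<and> J \<subseteq> S \<and> (\<forall>t. B t \<in> sets borel)}"
  define V where "V = {U -` B \<inter> space M | B. B \<in> sets borel}"
  have indep_E: "indep_set E V"
    unfolding indep_sets2_eq
  proof (intro conjI ballI)
    show "E \<subseteq> events"
    proof
      fix A assume "A \<in> E"
      then obtain J B where A: "A = {\<omega>\<in>space M. \<forall>t\<in>J. X t \<omega> \<in> B t}" "finite J" "J \<subseteq> S"
        and [measurable]: "\<And>t. B t \<in> sets borel" unfolding E_def by auto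
      have [measurable]: "X t \<in> borel_measurable M" if "t \<in> J" for t using meas A(3) that by auto
      show "A \<in> events" unfolding A(1) using A(2) by measurable
    qed
    show "V \<subseteq> events" unfolding V_def by auto
    fix A D assume "A \<in> E" "D \<in> V"
    then obtain J B where A: "A = {\<omega>\<in>space M. \<forall>t\<in>J. X t \<omega> \<in> B t}" "finite J" "J \<subseteq> S"
      and [measurable]: "\<And>t. B t \<in> sets borel" unfolding E_def by auto
    have [measurable]: "X t \<in> borel_measurable M" if "t \<in> J" for t using meas A(3) that by auto
    have [measurable]: "A \<in> events" unfolding A(1) using A(2) by measurable
    obtain C where D: "D = U -` C \<inter> space M" and [measurable]: "C \<in> sets borel"
      using \<open>D \<in> V\<close> unfolding V_def by auto
    have ind_A: "indicator A \<omega> = (\<Prod>t\<in>J. indicator (B t) (X t \<omega>) :: complex)"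
      if "\<omega> \<in> space M" for \<omega>
    proof (cases "\<omega> \<in> A")
      case True
      then have "(\<Prod>t\<in>J. indicator (B t) (X t \<omega>) :: complex) = (\<Prod>t\<in>J. 1)"
        by (intro prod.cong) (auto simp: A(1))
      then show ?thesis using True by simp
    next
      case False
      with that obtain t where "t \<in> J" "X t \<omega> \<notin> B t" unfolding A(1) by blast
      then show ?thesis using False A(2) by (auto simp: prod_zero_iff indicator_def)
    qed
    have iexp_int: "integrable M (\<lambda>\<omega>. iexp (f \<omega>))" if [measurable]: "f \<in> borel_measurable M" for f
      by (rule integrable_const_bound[of _ 1]) auto
    have iA: "integrable M (\<lambda>\<omega>. indicator A \<omega> :: complex)"
      by (rule integrable_const_bound[of _ 1]) (auto simp: indicator_def)
    have one: "(CLINT \<omega>|M. indicator A \<omega> * iexp (\<theta> * U \<omega>))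
        = prob A * (CLINT \<omega>|M. iexp (\<theta> * U \<omega>))" for \<theta>
    proof -
      define c where "c = (CLINT \<omega>|M. iexp (\<theta> * U \<omega>))"
      have c: "norm c \<le> 1"
      proof -
        have "norm c \<le> (\<integral>\<omega>. norm (iexp (\<theta> * U \<omega>)) \<partial>M)" unfolding c_def by (rule integral_norm_bound)
        then show ?thesis by (simp add: prob_space)
      qed
      have "(CLINT \<omega>|M. (iexp (\<theta> * U \<omega>) - c) * (\<Prod>t\<in>J. indicator (B t) (X t \<omega>))) = 0"
      proof (rule fourier_zero_family[where K=2])
        show "norm (iexp (\<theta> * U \<omega>) - c) \<le> 2" for \<omega>
          using norm_triangle_ineq4[of "iexp (\<theta> * U \<omega>)" c] c norm_exp_i_times[of "\<theta> * U \<omega>"] by linarith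
        fix \<phi>
        have "(CLINT \<omega>|M. (iexp (\<theta> * U \<omega>) - c) * iexp (\<Sum>t\<in>J. \<phi> t * X t \<omega>))
          = (CLINT \<omega>|M. iexp (\<theta> * U \<omega> + (\<Sum>t\<in>J. \<phi> t * X t \<omega>)) - c * iexp (\<Sum>t\<in>J. \<phi> t * X t \<omega>))"
          by (intro Bochner_Integration.integral_cong) (auto simp: algebra_simps exp_add simp del: of_real_sum)
        also have "\<dots> = (CLINT \<omega>|M. iexp (\<theta> * U \<omega> + (\<Sum>t\<in>J. \<phi> t * X t \<omega>)))
          - c * (CLINT \<omega>|M. iexp (\<Sum>t\<in>J. \<phi> t * X t \<omega>))"
          by (subst Bochner_Integration.integral_diff) (auto intro!: iexp_int integrable_mult_right simp del: of_real_sum of_real_add)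
        also have "\<dots> = 0" using factor[OF A(2,3), of \<theta> \<phi>]
          by (simp add: c_def algebra_simps exp_add del: of_real_sum)
        finally show "(CLINT \<omega>|M. (iexp (\<theta> * U \<omega>) - c) * iexp (\<Sum>t\<in>J. \<phi> t * X t \<omega>)) = 0" .
      qed (use A in auto)
      then have "0 = (CLINT \<omega>|M. (iexp (\<theta> * U \<omega>) - c) * indicator A \<omega>)"
        by (subst Bochner_Integration.integral_cong[OF refl]) (auto simp: ind_A)
      also have "\<dots> = (CLINT \<omega>|M. indicator A \<omega> * iexp (\<theta> * U \<omega>) - c * indicator A \<omega>)"
        by (intro Bochner_Integration.integral_cong) (auto simp: algebra_simps)
      also have "\<dots> = (CLINT \<omega>|M. indicator A \<omega> * iexp (\<theta> * U \<omega>)) - c * prob A"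
      proof -
        have "integrable M (\<lambda>\<omega>. indicator A \<omega> * iexp (\<theta> * U \<omega>))"
          by (rule integrable_const_bound[of _ 1]) (auto simp: indicator_def)
        moreover have "(CLINT \<omega>|M. indicator A \<omega>) = prob A"
          using integral_complex_of_real[of M "indicator A"] by (simp add: indicator_def of_bool_def if_distrib cong: if_cong)
        ultimately show ?thesis using iA by simp
      qed
      finally show ?thesis by (simp add: c_def)
    qed
    have "(\<integral>\<omega>. (indicator A \<omega> - prob A) * indicator C (U \<omega>) \<partial>M) = 0"
    proof (rule fourier_zero_real[where K=1])
      show "\<bar>indicator A \<omega> - prob A\<bar> \<le> 1" for \<omega> by (auto simp: indicator_def)
      fix \<theta>
      have "(CLINT \<omega>|M. complex_of_real (indicator A \<omega> - prob A) * iexp (\<theta> * U \<omega>))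
        = (CLINT \<omega>|M. indicator A \<omega> * iexp (\<theta> * U \<omega>) - prob A * iexp (\<theta> * U \<omega>))"
        by (intro Bochner_Integration.integral_cong) (auto simp: algebra_simps indicator_def)
      also have "\<dots> = (CLINT \<omega>|M. indicator A \<omega> * iexp (\<theta> * U \<omega>)) - prob A * (CLINT \<omega>|M. iexp (\<theta> * U \<omega>))"
      proof -
        have "integrable M (\<lambda>\<omega>. indicator A \<omega> * iexp (\<theta> * U \<omega>))"
          by (rule integrable_const_bound[of _ 1]) (auto simp: indicator_def)
        moreover have "integrable M (\<lambda>\<omega>. iexp (\<theta> * U \<omega>))" by (rule iexp_int) simp
        ultimately show ?thesis by simp
      qed
      also have "\<dots> = 0" using one[of \<theta>] by simp
      finally show "(CLINT \<omega>|M. complex_of_real (indicator A \<omega> - prob A) * iexp (\<theta> * U \<omega>)) = 0" .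
    qed simp_all
    also have "(\<integral>\<omega>. (indicator A \<omega> - prob A) * indicator C (U \<omega>) \<partial>M)
        = (\<integral>\<omega>. indicator (A \<inter> D) \<omega> - prob A * indicator D \<omega> \<partial>M)"
      by (intro Bochner_Integration.integral_cong) (auto simp: D indicator_def)
    also have "\<dots> = prob (A \<inter> D) - prob A * prob D"
      unfolding D by (subst Bochner_Integration.integral_diff) (auto intro!: integrable_real_indicator simp: emeasure_eq_measure)
    finally show "prob (A \<inter> D) = prob A * prob D" by simp
  qed
  have "Int_stable E"
  proof (rule Int_stableI)
    fix a b assume "a \<in> E" "b \<in> E"
    then obtain J B J' B' where a: "a = {\<omega>\<in>space M. \<forall>t\<in>J. X t \<omega> \<in> B t}" "finite J" "J \<subseteq> S" "\<And>t. B t \<in> sets borel"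
      and b: "b = {\<omega>\<in>space M. \<forall>t\<in>J'. X t \<omega> \<in> B' t}" "finite J'" "J' \<subseteq> S" "\<And>t. B' t \<in> sets borel"
      unfolding E_def by auto
    have "a \<inter> b = {\<omega>\<in>space M. \<forall>t\<in>J \<union> J'. X t \<omega> \<in> (if t \<in> J then B t else UNIV) \<inter> (if t \<in> J' then B' t else UNIV)}"
      unfolding a(1) b(1) by auto
    then show "a \<inter> b \<in> E" unfolding E_def
      using a b by (intro CollectI exI[of _ "J \<union> J'"]
        exI[of _ "\<lambda>t. (if t \<in> J then B t else UNIV) \<inter> (if t \<in> J' then B' t else UNIV)"]) auto
  qed
  moreover have "Int_stable V"
  proof (rule Int_stableI)
    fix a b assume "a \<in> V" "b \<in> V"
    then obtain A B where "a = U -` A \<inter> space M" "A \<in> sets borel" "b = U -` B \<inter> space M" "B \<in> sets borel"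
      unfolding V_def by auto
    then show "a \<inter> b \<in> V" unfolding V_def by (intro CollectI exI[of _ "A \<inter> B"]) auto
  qed
  ultimately have indep: "indep_set (sigma_sets (space M) E) (sigma_sets (space M) V)"
    using indep_E by (intro indep_set_sigma_sets)
  have "(\<Union>s\<in>S. {X s -` B \<inter> space M | B. B \<in> sets borel}) \<subseteq> E"
  proof clarsimp
    fix s B assume "s \<in> S" "B \<in> sets (borel :: real measure)"
    then show "X s -` B \<inter> space M \<in> E"
      unfolding E_def by (intro CollectI exI[of _ "{s}"] exI[of _ "\<lambda>_. B"]) auto
  qed
  then have "sigma_sets (space M) (\<Union>s\<in>S. {X s -` B \<inter> space M | B. B \<in> sets borel}) \<subseteq> sigma_sets (space M) E"
    by (rule sigma_sets_mono')
  then show ?thesis using indep unfolding indep_sets2_eq V_def by blast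
qed

section \<open>Isonormal Gaussian families\<close>

lemma AE_linear_sum:
  fixes I :: "'h::real_vector \<Rightarrow> 'a \<Rightarrow> real"
  assumes lin: "\<And>a b h k. AE \<omega> in M. I (a *\<^sub>R h + b *\<^sub>R k) \<omega> = a * I h \<omega> + b * I k \<omega>"
    and "finite J"
  shows "AE \<omega> in M. I (\<Sum>t\<in>J. a t *\<^sub>R h t) \<omega> = (\<Sum>t\<in>J. a t * I (h t) \<omega>)"
  using \<open>finite J\<close>
proof (induction J)
  case empty
  then show ?case using lin[of 0 0 0 0] by simp
next
  case (insert t J)
  have "AE \<omega> in M. I (a t *\<^sub>R h t + 1 *\<^sub>R (\<Sum>t\<in>J. a t *\<^sub>R h t)) \<omega>
      = a t * I (h t) \<omega> + 1 * I (\<Sum>t\<in>J. a t *\<^sub>R h t) \<omega>"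
    by (rule lin)
  with insert.IH have "AE \<omega> in M. I (a t *\<^sub>R h t + (\<Sum>t\<in>J. a t *\<^sub>R h t)) \<omega>
      = a t * I (h t) \<omega> + (\<Sum>t\<in>J. a t * I (h t) \<omega>)"
    by eventually_elim simp
  then show ?case using insert.hyps by simp
qed

lemma std_normal_exp_moment:
  "has_bochner_integral std_normal_distribution (\<lambda>x. exp (s * x)) (exp (s\<^sup>2 / 2))"
proof -
  \<comment> \<open>completing the square\<close>
  have eq: "std_normal_density x * exp (s * x) = exp (s\<^sup>2 / 2) * normal_density s 1 x" for x :: real
  proof -
    have "- x\<^sup>2 / 2 + s * x = s\<^sup>2 / 2 + - (x - s)\<^sup>2 / 2"
      by (simp add: power2_eq_square field_simps)
    then have "exp (- x\<^sup>2 / 2) * exp (s * x) = exp (s\<^sup>2 / 2) * exp (- (x - s)\<^sup>2 / 2)"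
      by (simp only: exp_add[symmetric])
    then show ?thesis by (simp add: normal_density_def field_simps)
  qed
  have "has_bochner_integral lborel (\<lambda>x. std_normal_density x *\<^sub>R exp (s * x)) (exp (s\<^sup>2 / 2))"
    unfolding real_scaleR_def eq
    using has_bochner_integral_mult_right[of "exp (s\<^sup>2 / 2)" lborel "normal_density s 1" 1]
    by (simp add: has_bochner_integral_iff)
  then show ?thesis
    by (intro has_bochner_integral_density) auto
qed

text \<open>
  The interface through which the Wiener integral is used: linearity up to null sets, and centered
  Gaussian laws with variance \<open>|h|\<^sup>2\<close>, expressed by characteristic functions. By linearity the
  single value at frequency one determines the whole characteristic function, and joint laws.
\<close>

locale isonormal = prob_space M for M :: "'a measure" +
  fixes I :: "'h::real_inner \<Rightarrow> 'a \<Rightarrow> real"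
  assumes I_measurable [measurable]: "I h \<in> borel_measurable M"
    and I_linear: "AE \<omega> in M. I (a *\<^sub>R h + b *\<^sub>R k) \<omega> = a * I h \<omega> + b * I k \<omega>"
    and I_char: "(CLINT \<omega>|M. iexp (I h \<omega>)) = exp (- (norm h)\<^sup>2 / 2)"
begin

lemma I_add: "AE \<omega> in M. I (h + k) \<omega> = I h \<omega> + I k \<omega>"
  using I_linear[of 1 h 1 k] by simp

lemma I_scale: "AE \<omega> in M. I (a *\<^sub>R h) \<omega> = a * I h \<omega>"
  using I_linear[of a h 0 h] by simp

lemma I_diff: "AE \<omega> in M. I (h - k) \<omega> = I h \<omega> - I k \<omega>"
  using I_linear[of 1 h "-1" k] by simp

lemma I_zero: "AE \<omega> in M. I 0 \<omega> = 0"
  using I_scale[of 0 0] by simp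

lemmas I_sum = AE_linear_sum[where I = I, OF I_linear]

lemma I_char_scaled: "(CLINT \<omega>|M. iexp (t * I h \<omega>)) = exp (- t\<^sup>2 * (norm h)\<^sup>2 / 2)"
proof -
  have "(CLINT \<omega>|M. iexp (t * I h \<omega>)) = (CLINT \<omega>|M. iexp (I (t *\<^sub>R h) \<omega>))"
    by (intro integral_cong_AE) (use I_scale[of t h] in auto)
  then show ?thesis by (simp add: I_char power_mult_distrib)
qed

text \<open>
  Restricted to unit vectors so that the law is the standard normal one; other vectors are reached
  by scaling, and the zero vector has no density.
\<close>

lemma I_distr:
  assumes "norm h = 1"
  shows "distr M borel (I h) = std_normal_distribution"
proof (rule Levy_uniqueness)
  show "real_distribution (distr M borel (I h))" by simp
  show "real_distribution std_normal_distribution" by (rule real_dist_normal_dist)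
  show "char (distr M borel (I h)) = char std_normal_distribution"
  proof
    fix t
    have "char (distr M borel (I h)) t = (CLINT \<omega>|M. iexp (t * I h \<omega>))"
      unfolding char_def by (subst integral_distr) auto
    then show "char (distr M borel (I h)) t = char std_normal_distribution t"
      using assms I_char_scaled[of t h] by (simp add: char_std_normal_distribution exp_of_real[symmetric])
  qed
qed

lemma I_exp:
  shows integrable_exp_I: "integrable M (\<lambda>\<omega>. exp (I h \<omega>))"
    and integral_exp_I: "(\<integral>\<omega>. exp (I h \<omega>) \<partial>M) = exp ((norm h)\<^sup>2 / 2)"
proof -
  have "has_bochner_integral M (\<lambda>\<omega>. exp (I h \<omega>)) (exp ((norm h)\<^sup>2 / 2))"
  proof (cases "h = 0")
    case True
    have "has_bochner_integral M (\<lambda>\<omega>. 1) (1::real)"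
      by (simp add: has_bochner_integral_iff prob_space)
    then show ?thesis
      using True I_zero by (subst has_bochner_integral_cong_AE[where g = "\<lambda>_. 1"]) auto
  next
    case False
    define e where "e = (1 / norm h) *\<^sub>R h"
    have e: "norm e = 1" "h = norm h *\<^sub>R e" using False by (auto simp: e_def)
    have "has_bochner_integral (distr M borel (I e)) (\<lambda>x. exp (norm h * x)) (exp ((norm h)\<^sup>2 / 2))"
      unfolding I_distr[OF e(1)] by (rule std_normal_exp_moment)
    then have "has_bochner_integral M (\<lambda>\<omega>. exp (norm h * I e \<omega>)) (exp ((norm h)\<^sup>2 / 2))"
      by (simp add: has_bochner_integral_iff integrable_distr_eq integral_distr)
    moreover have "AE \<omega> in M. exp (I h \<omega>) = exp (norm h * I e \<omega>)"
      using I_scale[of "norm h" e] e(2) by auto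
    ultimately show ?thesis
      by (subst has_bochner_integral_cong_AE[where g = "\<lambda>\<omega>. exp (norm h * I e \<omega>)"]) auto
  qed
  then show "integrable M (\<lambda>\<omega>. exp (I h \<omega>))" "(\<integral>\<omega>. exp (I h \<omega>) \<partial>M) = exp ((norm h)\<^sup>2 / 2)"
    by (auto simp: has_bochner_integral_iff)
qed

text \<open>
  For \<open>z\<close> in the span of the \<open>v\<^sub>t\<close>, Pythagoras gives \<open>|\<theta> q + z|\<^sup>2 = \<theta>\<^sup>2|q|\<^sup>2 + |z|\<^sup>2\<close>, so the joint
  characteristic function factors.
\<close>

lemma indep_of_orthogonal:
  fixes X :: "'j \<Rightarrow> 'a \<Rightarrow> real"
  assumes meas: "\<And>t. t \<in> S \<Longrightarrow> X t \<in> borel_measurable M"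
    and X: "\<And>t. t \<in> S \<Longrightarrow> AE \<omega> in M. X t \<omega> = I (v t) \<omega>"
    and orth: "\<And>t. t \<in> S \<Longrightarrow> inner q (v t) = 0"
  shows "indep_set (sigma_sets (space M) (\<Union>s\<in>S. {X s -` B \<inter> space M | B. B \<in> sets borel}))
    (sigma_sets (space M) {I q -` B \<inter> space M | B. B \<in> sets borel})"
proof (rule indep_set_of_fourier[OF meas])
  fix J \<phi> \<theta> assume J: "finite J" "J \<subseteq> S"
  have [measurable]: "X t \<in> borel_measurable M" if "t \<in> J" for t using meas J that by auto
  define z where "z = (\<Sum>t\<in>J. \<phi> t *\<^sub>R v t)"
  have qz: "inner q z = 0" unfolding z_def using orth J by (auto simp: inner_sum_right intro!: sum.neutral)
  have "AE \<omega> in M. \<forall>t\<in>J. X t \<omega> = I (v t) \<omega>" using X J by (intro AE_finite_allI) auto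
  with I_sum[OF J(1), of \<phi> v] have Xz: "AE \<omega> in M. (\<Sum>t\<in>J. \<phi> t * X t \<omega>) = I z \<omega>"
    unfolding z_def by eventually_elim simp
  have "(CLINT \<omega>|M. iexp (\<theta> * I q \<omega>) * iexp (\<Sum>t\<in>J. \<phi> t * X t \<omega>))
      = (CLINT \<omega>|M. iexp (I (\<theta> *\<^sub>R q + 1 *\<^sub>R z) \<omega>))"
  proof (rule integral_cong_AE)
    show "AE \<omega> in M. iexp (\<theta> * I q \<omega>) * iexp (\<Sum>t\<in>J. \<phi> t * X t \<omega>) = iexp (I (\<theta> *\<^sub>R q + 1 *\<^sub>R z) \<omega>)"
      using Xz I_linear[of \<theta> q 1 z]
      by eventually_elim (simp add: exp_add distrib_left del: of_real_sum)
  qed simp_all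
  also have "\<dots> = exp (- (norm (\<theta> *\<^sub>R q + 1 *\<^sub>R z))\<^sup>2 / 2)" by (rule I_char)
  also have "(norm (\<theta> *\<^sub>R q + 1 *\<^sub>R z))\<^sup>2 = \<theta>\<^sup>2 * (norm q)\<^sup>2 + (norm z)\<^sup>2"
    unfolding power2_norm_eq_inner using qz
    by (simp add: inner_simps inner_commute power2_eq_square)
  also have "exp (- (\<theta>\<^sup>2 * (norm q)\<^sup>2 + (norm z)\<^sup>2) / 2) = exp (- \<theta>\<^sup>2 * (norm q)\<^sup>2 / 2) * exp (- (norm z)\<^sup>2 / 2)"
    by (simp add: exp_add[symmetric] field_simps)
  also have "complex_of_real \<dots> = (CLINT \<omega>|M. iexp (\<theta> * I q \<omega>)) * (CLINT \<omega>|M. iexp (I z \<omega>))"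
    unfolding I_char I_char_scaled by simp
  also have "(CLINT \<omega>|M. iexp (I z \<omega>)) = (CLINT \<omega>|M. iexp (\<Sum>t\<in>J. \<phi> t * X t \<omega>))"
    by (rule integral_cong_AE) (use Xz in \<open>auto simp del: of_real_sum\<close>)
  finally show "(CLINT \<omega>|M. iexp (\<theta> * I q \<omega>) * iexp (\<Sum>t\<in>J. \<phi> t * X t \<omega>))
    = (CLINT \<omega>|M. iexp (\<theta> * I q \<omega>)) * (CLINT \<omega>|M. iexp (\<Sum>t\<in>J. \<phi> t * X t \<omega>))" .
qed (auto intro: I_measurable)

lemma expectation_mult_orthogonal:
  fixes X :: "'j \<Rightarrow> 'a \<Rightarrow> real" and f :: "real \<Rightarrow> real"
  assumes meas: "\<And>t. t \<in> S \<Longrightarrow> X t \<in> borel_measurable M"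
    and X: "\<And>t. t \<in> S \<Longrightarrow> AE \<omega> in M. X t \<omega> = I (v t) \<omega>"
    and orth: "\<And>t. t \<in> S \<Longrightarrow> inner q (v t) = 0"
    and Z: "Z \<in> borel_measurable (sigma (space M) (\<Union>s\<in>S. {X s -` B \<inter> space M | B. B \<in> sets borel}))"
    and f: "f \<in> borel_measurable borel"
    and int: "integrable M Z" "integrable M (\<lambda>\<omega>. f (I q \<omega>))"
  shows "(\<integral>\<omega>. Z \<omega> * f (I q \<omega>) \<partial>M) = (\<integral>\<omega>. Z \<omega> \<partial>M) * (\<integral>\<omega>. f (I q \<omega>) \<partial>M)"
proof -
  let ?G = "\<Union>s\<in>S. {X s -` B \<inter> space M | B. B \<in> sets borel}"
  have "?G \<subseteq> Pow (space M)" by auto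
  then have sets_G: "sets (sigma (space M) ?G) = sigma_sets (space M) ?G" by (rule sets_measure_of)
  have "{Z -` A \<inter> space M | A. A \<in> sets borel} \<subseteq> sigma_sets (space M) ?G"
    using measurable_sets[OF Z] sets_G by (auto simp: space_measure_of_conv)
  then have "sigma_sets (space M) {Z -` A \<inter> space M | A. A \<in> sets borel} \<subseteq> sigma_sets (space M) ?G"
    by (rule sigma_sets_mono)
  moreover have ind: "indep_set (sigma_sets (space M) ?G)
      (sigma_sets (space M) {I q -` B \<inter> space M | B. B \<in> sets borel})"
    by (rule indep_of_orthogonal[OF meas X orth])
  ultimately have "indep_set (sigma_sets (space M) {Z -` A \<inter> space M | A. A \<in> sets borel})
      (sigma_sets (space M) {I q -` B \<inter> space M | B. B \<in> sets borel})"
    unfolding indep_set_def by (elim indep_sets_mono_sets) (simp split: bool.split)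
  then have "indep_var borel Z borel (I q)"
    unfolding indep_var_eq using borel_measurable_integrable[OF int(1)] I_measurable[of q] by blast
  then have "indep_var borel ((\<lambda>x. x) \<circ> Z) borel (f \<circ> I q)"
    by (rule indep_var_compose) (use f in auto)
  then show ?thesis using int by (intro indep_var_lebesgue_integral) (auto simp: comp_def)
qed

end

section \<open>Existence of the Wiener integral\<close>

text \<open>
  The characteristic function has the same form for a degenerate and a nondegenerate Gaussian
  variable, so the case distinction in the definition disappears from here on.
\<close>

lemma (in prob_space) gaussian_rv_square_integrable:
  assumes "gaussian_rv M Y"
  shows "integrable M (\<lambda>\<omega>. (Y \<omega>)\<^sup>2)"
    and "(\<integral>\<omega>. Y \<omega> \<partial>M) = 0 \<Longrightarrow> (CLINT \<omega>|M. iexp (Y \<omega>)) = exp (- (\<integral>\<omega>. (Y \<omega>)\<^sup>2 \<partial>M) / 2)"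
proof -
  have [measurable]: "Y \<in> borel_measurable M" using assms unfolding gaussian_rv_def by simp
  obtain \<mu> where "(AE \<omega> in M. Y \<omega> = \<mu>) \<or> (\<exists>\<sigma>>0. distributed M lborel Y (normal_density \<mu> \<sigma>))"
    using assms unfolding gaussian_rv_def by auto
  then have "integrable M (\<lambda>\<omega>. (Y \<omega>)\<^sup>2) \<and> ((\<integral>\<omega>. Y \<omega> \<partial>M) = 0 \<longrightarrow>
    (CLINT \<omega>|M. iexp (Y \<omega>)) = exp (- (\<integral>\<omega>. (Y \<omega>)\<^sup>2 \<partial>M) / 2))"
  proof
    assume *: "AE \<omega> in M. Y \<omega> = \<mu>"
    have "integrable M (\<lambda>\<omega>. (Y \<omega>)\<^sup>2) \<longleftrightarrow> integrable M (\<lambda>\<omega>. \<mu>\<^sup>2)"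
      by (rule integrable_cong_AE) (use * in auto)
    moreover have "(\<integral>\<omega>. Y \<omega> \<partial>M) = (\<integral>\<omega>. \<mu> \<partial>M)" "(\<integral>\<omega>. (Y \<omega>)\<^sup>2 \<partial>M) = (\<integral>\<omega>. \<mu>\<^sup>2 \<partial>M)"
      "(CLINT \<omega>|M. iexp (Y \<omega>)) = (CLINT \<omega>|M. iexp \<mu>)"
      by (rule integral_cong_AE; use * in auto)+
    ultimately show ?thesis by (simp add: prob_space)
  next
    assume "\<exists>\<sigma>>0. distributed M lborel Y (normal_density \<mu> \<sigma>)"
    then obtain \<sigma> where \<sigma>: "\<sigma> > 0" and Y: "distributed M lborel Y (normal_density \<mu> \<sigma>)" by auto
    define N where "N \<omega> = (Y \<omega> - \<mu>) / \<sigma>" for \<omega>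
    have [measurable]: "N \<in> borel_measurable M" unfolding N_def by simp
    have dN: "distributed M lborel N std_normal_density"
      using normal_standard_normal_convert[OF \<sigma>, of Y \<mu>] Y unfolding N_def by simp
    have distr: "distr M borel N = std_normal_distribution"
      using distributed_distr_eq_density[OF dN] by (simp cong: distr_cong)
    have N2: "integrable M (\<lambda>\<omega>. (N \<omega>)\<^sup>2)"
      using distributed_integrable[OF dN, of "\<lambda>x. x\<^sup>2"] integrable_std_normal_moment[of 2] by simp
    have N2': "(\<integral>\<omega>. (N \<omega>)\<^sup>2 \<partial>M) = 1"
      using standard_normal_distributed_variance[OF dN] standard_normal_distributed_expectation[OF dN] by simp
    have eq: "Y \<omega> = \<sigma> * N \<omega> + \<mu> * 1" for \<omega> using \<sigma> by (simp add: N_def)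
    have "integrable M (\<lambda>\<omega>. (Y \<omega>)\<^sup>2)"
      unfolding eq by (rule L2_lincomb_integrable(1)) (use N2 in auto)
    moreover have "(CLINT \<omega>|M. iexp (Y \<omega>)) = exp (- (\<integral>\<omega>. (Y \<omega>)\<^sup>2 \<partial>M) / 2)"
      if "(\<integral>\<omega>. Y \<omega> \<partial>M) = 0"
    proof -
      have "\<mu> = 0" using normal_distributed_expectation[OF \<sigma> Y] that by simp
      then have eq: "Y \<omega> = \<sigma> * N \<omega>" for \<omega> using eq by simp
      have "(CLINT \<omega>|M. iexp (\<sigma> * N \<omega>)) = char (distr M borel N) \<sigma>"
        unfolding char_def by (subst integral_distr) auto
      also have "\<dots> = exp (- \<sigma>\<^sup>2 / 2)"
        unfolding distr char_std_normal_distribution by (simp add: exp_of_real[symmetric])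
      finally show ?thesis unfolding eq by (simp add: power_mult_distrib N2')
    qed
    ultimately show ?thesis by simp
  qed
  then show "integrable M (\<lambda>\<omega>. (Y \<omega>)\<^sup>2)"
    and "(\<integral>\<omega>. Y \<omega> \<partial>M) = 0 \<Longrightarrow> (CLINT \<omega>|M. iexp (Y \<omega>)) = exp (- (\<integral>\<omega>. (Y \<omega>)\<^sup>2 \<partial>M) / 2)"
    by auto
qed

lemma (in prob_space) iexp_L2_dist:
  assumes [measurable]: "F \<in> borel_measurable M" "Z \<in> borel_measurable M"
    and int: "integrable M (\<lambda>\<omega>. (F \<omega> - Z \<omega>)\<^sup>2)"
  shows "norm ((CLINT \<omega>|M. iexp (F \<omega>)) - (CLINT \<omega>|M. iexp (Z \<omega>))) \<le> sqrt (\<integral>\<omega>. (F \<omega> - Z \<omega>)\<^sup>2 \<partial>M)"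
proof -
  have iexp_int: "integrable M (\<lambda>\<omega>. iexp (f \<omega>))" if [measurable]: "f \<in> borel_measurable M" for f
    by (rule integrable_const_bound[of _ 1]) auto
  have le: "norm (iexp a - iexp b) \<le> \<bar>a - b\<bar>" for a b
  proof -
    have "iexp a - iexp b = iexp b * (iexp (a - b) - 1)"
      by (simp add: algebra_simps exp_add[symmetric])
    then have "norm (iexp a - iexp b) = norm (iexp (a - b) - 1)"
      by (simp only: norm_mult norm_exp_i_times mult_1_left)
    then show ?thesis using iexp_approx1[of "a - b" 0] by simp
  qed
  have "(CLINT \<omega>|M. iexp (F \<omega>)) - (CLINT \<omega>|M. iexp (Z \<omega>)) = (CLINT \<omega>|M. iexp (F \<omega>) - iexp (Z \<omega>))"
    by (subst Bochner_Integration.integral_diff) (auto intro!: iexp_int)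
  also have "norm \<dots> \<le> (\<integral>\<omega>. norm (iexp (F \<omega>) - iexp (Z \<omega>)) \<partial>M)" by (rule integral_norm_bound)
  also have "\<dots> \<le> (\<integral>\<omega>. \<bar>F \<omega> - Z \<omega>\<bar> \<partial>M)"
    using L1_le_L2(1)[OF _ int]
    by (intro integral_mono le) (auto intro!: iexp_int integrable_norm Bochner_Integration.integrable_diff)
  also have "\<dots> \<le> sqrt (\<integral>\<omega>. (F \<omega> - Z \<omega>)\<^sup>2 \<partial>M)"
    using L1_le_L2(2)[OF _ int] by (intro real_le_rsqrt) simp
  finally show ?thesis .
qed

locale gaussian_setting = prob_space M for M :: "'a measure" +
  fixes T :: real and X :: "real \<Rightarrow> 'a \<Rightarrow> real"
    and \<iota> :: "(real \<Rightarrow> real) \<Rightarrow> 'h::{real_inner, complete_space}"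
  assumes gaussian: "gaussian_process M T X" and centered: "centered_process M T X"
    and integrands: "integrand_space T (covariance M X) \<iota>"
begin

abbreviation \<e> :: "real \<Rightarrow> 'h" where "\<e> t \<equiv> \<iota> (ind t)"

lemma gaussian_lincomb: "finite A \<Longrightarrow> A \<subseteq> {0..T} \<Longrightarrow> gaussian_rv M (\<lambda>\<omega>. \<Sum>t\<in>A. a t * X t \<omega>)"
  using gaussian unfolding gaussian_process_def by blast

lemma gaussian_X: "t \<in> {0..T} \<Longrightarrow> gaussian_rv M (X t)"
  using gaussian_lincomb[of "{t}" "\<lambda>_. 1"] by simp

lemma X_measurable: "t \<in> {0..T} \<Longrightarrow> X t \<in> borel_measurable M"
  using gaussian_X by (auto simp: gaussian_rv_def)

lemma X_square_integrable: "t \<in> {0..T} \<Longrightarrow> integrable M (\<lambda>\<omega>. (X t \<omega>)\<^sup>2)"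
  using gaussian_rv_square_integrable(1)[OF gaussian_X] .

lemma X_integrable: "t \<in> {0..T} \<Longrightarrow> integrable M (X t)"
  using L1_le_L2(1)[OF X_measurable X_square_integrable] .

lemma X_mult_integrable: "s \<in> {0..T} \<Longrightarrow> t \<in> {0..T} \<Longrightarrow> integrable M (\<lambda>\<omega>. X s \<omega> * X t \<omega>)"
  by (intro L2_mult_integrable X_measurable X_square_integrable)

lemma inner_\<e>: "s \<in> {0..T} \<Longrightarrow> t \<in> {0..T} \<Longrightarrow> inner (\<e> s) (\<e> t) = (\<integral>\<omega>. X s \<omega> * X t \<omega> \<partial>M)"
  using integrands unfolding integrand_space_def covariance_def by blast

lemma span_indicators_dense: "closure (span (\<e> ` {0..T})) = UNIV"
  using integrands unfolding integrand_space_def by simp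

lemma sets_filtration: "sets (generated_filtration M X r)
    = sigma_sets (space M) (\<Union>s\<in>{0..r}. {X s -` B \<inter> space M | B. B \<in> sets borel})"
  unfolding generated_filtration_def by (rule sets_measure_of) auto

lemma space_filtration: "space (generated_filtration M X r) = space M"
  unfolding generated_filtration_def by (simp add: space_measure_of_conv)

lemma subalgebra_filtration: "r \<le> T \<Longrightarrow> subalgebra M (generated_filtration M X r)"
  unfolding subalgebra_def space_filtration sets_filtration
  by (intro conjI refl sets.sigma_sets_subset) (use X_measurable in \<open>auto intro: measurable_sets\<close>)

lemma subalgebra_filtration_mono:
  "r \<le> s \<Longrightarrow> subalgebra (generated_filtration M X s) (generated_filtration M X r)"
  unfolding subalgebra_def space_filtration sets_filtration
  by (intro conjI refl sigma_sets_mono') fastforce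

lemma X_adapted: "0 \<le> s \<Longrightarrow> s \<le> r \<Longrightarrow> X s \<in> borel_measurable (generated_filtration M X r)"
  unfolding measurable_def space_filtration sets_filtration
  by (auto intro!: sigma_sets.Basic bexI[of _ s] exI)

text \<open>
  The integrals of step functions. As \<open>k\<close> may have several representations, \<open>Z\<close> is a relation to \<open>k\<close>
  and not a function of it; the isometry makes it unique up to null sets.
\<close>

definition elementary :: "real \<Rightarrow> 'h \<Rightarrow> ('a \<Rightarrow> real) \<Rightarrow> bool" where
  "elementary r k Z \<longleftrightarrow> (\<exists>A a. finite A \<and> A \<subseteq> {0..r} \<and>
     k = (\<Sum>t\<in>A. a t *\<^sub>R \<e> t) \<and> Z = (\<lambda>\<omega>. \<Sum>t\<in>A. a t * X t \<omega>))"

lemma elementary_mono: "elementary r k Z \<Longrightarrow> r \<le> s \<Longrightarrow> elementary s k Z"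
  unfolding elementary_def by fastforce

lemma elementary_lincomb:
  assumes "elementary r k Z" "elementary r k' Z'"
  shows "elementary r (a *\<^sub>R k + b *\<^sub>R k') (\<lambda>\<omega>. a * Z \<omega> + b * Z' \<omega>)"
proof -
  obtain A c where A: "finite A" "A \<subseteq> {0..r}" "k = (\<Sum>t\<in>A. c t *\<^sub>R \<e> t)" "Z = (\<lambda>\<omega>. \<Sum>t\<in>A. c t * X t \<omega>)"
    using assms(1) unfolding elementary_def by auto
  obtain B d where B: "finite B" "B \<subseteq> {0..r}" "k' = (\<Sum>t\<in>B. d t *\<^sub>R \<e> t)" "Z' = (\<lambda>\<omega>. \<Sum>t\<in>B. d t * X t \<omega>)"
    using assms(2) unfolding elementary_def by auto
  define f where "f t = a * (if t \<in> A then c t else 0) + b * (if t \<in> B then d t else 0)" for t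
  have "a *\<^sub>R k = (\<Sum>t\<in>A \<union> B. (a * (if t \<in> A then c t else 0)) *\<^sub>R \<e> t)"
    unfolding A(3) scaleR_sum_right using A(1) B(1) by (intro sum.mono_neutral_cong_left) auto
  moreover have "b *\<^sub>R k' = (\<Sum>t\<in>A \<union> B. (b * (if t \<in> B then d t else 0)) *\<^sub>R \<e> t)"
    unfolding B(3) scaleR_sum_right using A(1) B(1) by (intro sum.mono_neutral_cong_left) auto
  ultimately have 1: "a *\<^sub>R k + b *\<^sub>R k' = (\<Sum>t\<in>A \<union> B. f t *\<^sub>R \<e> t)"
    by (simp add: f_def scaleR_add_left sum.distrib)
  have "a * Z \<omega> = (\<Sum>t\<in>A \<union> B. (a * (if t \<in> A then c t else 0)) * X t \<omega>)" for \<omega>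
    unfolding A(4) sum_distrib_left using A(1) B(1) by (intro sum.mono_neutral_cong_left) auto
  moreover have "b * Z' \<omega> = (\<Sum>t\<in>A \<union> B. (b * (if t \<in> B then d t else 0)) * X t \<omega>)" for \<omega>
    unfolding B(4) sum_distrib_left using A(1) B(1) by (intro sum.mono_neutral_cong_left) auto
  ultimately have 2: "(\<lambda>\<omega>. a * Z \<omega> + b * Z' \<omega>) = (\<lambda>\<omega>. \<Sum>t\<in>A \<union> B. f t * X t \<omega>)"
    by (simp add: f_def distrib_right sum.distrib)
  show ?thesis unfolding elementary_def
    using 1 2 A(1,2) B(1,2) by (intro exI[of _ "A \<union> B"] exI[of _ f]) auto
qed

lemma elementary_\<e>: "0 \<le> t \<Longrightarrow> t \<le> r \<Longrightarrow> elementary r (\<e> t) (X t)"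
  unfolding elementary_def by (intro exI[of _ "{t}"] exI[of _ "\<lambda>_. 1"]) auto

lemma elementary_exists:
  assumes "k \<in> span (\<e> ` {0..r})"
  shows "\<exists>Z. elementary r k Z"
  using assms
proof (induction rule: span_induct_alt)
  case base
  show ?case unfolding elementary_def by (intro exI[of _ "\<lambda>_. 0"] exI[of _ "{}"]) auto
next
  case (step c x y)
  then obtain t where t: "x = \<e> t" "0 \<le> t" "t \<le> r" by auto
  from step obtain Z where "elementary r y Z" by auto
  from elementary_lincomb[OF elementary_\<e>[OF t(2,3)] this, of c 1]
  show ?case using t by auto
qed

lemma elementary_adapted: "elementary r k Z \<Longrightarrow> Z \<in> borel_measurable (generated_filtration M X r)"
  unfolding elementary_def using X_adapted by (auto intro!: borel_measurable_sum borel_measurable_times)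

lemma elementary_measurable: "elementary T k Z \<Longrightarrow> Z \<in> borel_measurable M"
  using measurable_from_subalg[OF subalgebra_filtration elementary_adapted, of T k Z] by simp

lemma elementary_gaussian: "elementary T k Z \<Longrightarrow> gaussian_rv M Z"
  unfolding elementary_def using gaussian_lincomb by auto

lemma elementary_square:
  assumes "elementary T k Z"
  shows "integrable M (\<lambda>\<omega>. (Z \<omega>)\<^sup>2)" and "(\<integral>\<omega>. (Z \<omega>)\<^sup>2 \<partial>M) = (norm k)\<^sup>2"
proof -
  show "integrable M (\<lambda>\<omega>. (Z \<omega>)\<^sup>2)"
    using gaussian_rv_square_integrable(1)[OF elementary_gaussian[OF assms]] .
  obtain A c where A: "finite A" "A \<subseteq> {0..T}" "k = (\<Sum>t\<in>A. c t *\<^sub>R \<e> t)" "Z = (\<lambda>\<omega>. \<Sum>t\<in>A. c t * X t \<omega>)"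
    using assms unfolding elementary_def by auto
  have "(\<integral>\<omega>. (Z \<omega>)\<^sup>2 \<partial>M) = (\<integral>\<omega>. (\<Sum>s\<in>A. \<Sum>t\<in>A. (c s * c t) * (X s \<omega> * X t \<omega>)) \<partial>M)"
    unfolding A(4) power2_eq_square sum_product by (simp add: mult_ac)
  also have "\<dots> = (\<Sum>s\<in>A. \<Sum>t\<in>A. (c s * c t) * (\<integral>\<omega>. X s \<omega> * X t \<omega> \<partial>M))"
  proof -
    have i: "integrable M (\<lambda>\<omega>. (c s * c t) * (X s \<omega> * X t \<omega>))" if "s \<in> A" "t \<in> A" for s t
      using A(2) that by (intro integrable_mult_right X_mult_integrable) auto
    have "(\<integral>\<omega>. (\<Sum>s\<in>A. \<Sum>t\<in>A. (c s * c t) * (X s \<omega> * X t \<omega>)) \<partial>M)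
        = (\<Sum>s\<in>A. \<integral>\<omega>. (\<Sum>t\<in>A. (c s * c t) * (X s \<omega> * X t \<omega>)) \<partial>M)"
      using i by (intro Bochner_Integration.integral_sum Bochner_Integration.integrable_sum)
    also have "\<dots> = (\<Sum>s\<in>A. \<Sum>t\<in>A. \<integral>\<omega>. (c s * c t) * (X s \<omega> * X t \<omega>) \<partial>M)"
      using i by (intro sum.cong refl Bochner_Integration.integral_sum)
    finally show ?thesis by simp
  qed
  also have "\<dots> = (\<Sum>s\<in>A. \<Sum>t\<in>A. (c s * c t) * inner (\<e> s) (\<e> t))"
    using A(2) by (intro sum.cong refl) (auto simp: inner_\<e> subset_iff)
  also have "\<dots> = inner k k"
    unfolding A(3) inner_sum_left inner_sum_right by (simp add: mult_ac inner_commute)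
  finally show "(\<integral>\<omega>. (Z \<omega>)\<^sup>2 \<partial>M) = (norm k)\<^sup>2" by (simp add: power2_norm_eq_inner)
qed

lemma elementary_char:
  assumes "elementary T k Z"
  shows "(CLINT \<omega>|M. iexp (Z \<omega>)) = exp (- (norm k)\<^sup>2 / 2)"
proof -
  obtain A c where A: "finite A" "A \<subseteq> {0..T}" "Z = (\<lambda>\<omega>. \<Sum>t\<in>A. c t * X t \<omega>)"
    using assms unfolding elementary_def by auto
  have "(\<integral>\<omega>. Z \<omega> \<partial>M) = (\<Sum>t\<in>A. c t * (\<integral>\<omega>. X t \<omega> \<partial>M))"
    unfolding A(3) using A(2) X_integrable by (subst Bochner_Integration.integral_sum) auto
  also have "\<dots> = 0"
    using centered A(2) unfolding centered_process_def by (intro sum.neutral) auto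
  finally show ?thesis
    using gaussian_rv_square_integrable(2)[OF elementary_gaussian[OF assms]] elementary_square(2)[OF assms] by simp
qed

text \<open>
  \<open>F\<close> is a version of the Wiener integral of \<open>h\<close>: a mean-square limit of elementary integrals whose
  integrands converge to \<open>h\<close>.
\<close>

definition chaos_rep :: "'h \<Rightarrow> ('a \<Rightarrow> real) \<Rightarrow> bool" where
  "chaos_rep h F \<longleftrightarrow> F \<in> borel_measurable M \<and> (\<exists>k Z. (\<forall>n. elementary T (k n) (Z n)) \<and> k \<longlonglongrightarrow> h \<and>
     (\<forall>n. integrable M (\<lambda>\<omega>. (F \<omega> - Z n \<omega>)\<^sup>2)) \<and> (\<lambda>n. \<integral>\<omega>. (F \<omega> - Z n \<omega>)\<^sup>2 \<partial>M) \<longlonglongrightarrow> 0)"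

text \<open>
  Isometry and Gaussian law pass to mean-square limits: second moments by the Cauchy-Schwarz
  inequality, characteristic functions because \<open>x \<mapsto> exp (i x)\<close> is 1-Lipschitz.
\<close>

lemma chaos_rep_square:
  assumes "chaos_rep h F"
  shows "integrable M (\<lambda>\<omega>. (F \<omega>)\<^sup>2)" and "(\<integral>\<omega>. (F \<omega>)\<^sup>2 \<partial>M) = (norm h)\<^sup>2"
    and "(CLINT \<omega>|M. iexp (F \<omega>)) = exp (- (norm h)\<^sup>2 / 2)"
proof -
  obtain k Z where [measurable]: "F \<in> borel_measurable M" and el: "\<And>n. elementary T (k n) (Z n)" and k: "k \<longlonglongrightarrow> h"
    and int: "\<And>n. integrable M (\<lambda>\<omega>. (F \<omega> - Z n \<omega>)\<^sup>2)"
    and lim: "(\<lambda>n. \<integral>\<omega>. (F \<omega> - Z n \<omega>)\<^sup>2 \<partial>M) \<longlonglongrightarrow> 0"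
    using assms unfolding chaos_rep_def by auto
  have [measurable]: "Z n \<in> borel_measurable M" for n using elementary_measurable[OF el] .
  define D where "D n \<omega> = F \<omega> - Z n \<omega>" for n \<omega>
  have [measurable]: "D n \<in> borel_measurable M" for n unfolding D_def by simp
  have D: "integrable M (\<lambda>\<omega>. (D n \<omega>)\<^sup>2)" for n using int unfolding D_def .
  define d where "d n = (\<integral>\<omega>. (D n \<omega>)\<^sup>2 \<partial>M)" for n
  have d: "d \<longlonglongrightarrow> 0" using lim unfolding d_def D_def .
  have F: "F \<omega> = 1 * D n \<omega> + 1 * Z n \<omega>" for n \<omega> by (simp add: D_def)
  have nk: "(\<lambda>n. norm (k n)) \<longlonglongrightarrow> norm h" using k by (rule tendsto_norm)
  show "integrable M (\<lambda>\<omega>. (F \<omega>)\<^sup>2)"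
    unfolding F[of _ 0] by (rule L2_lincomb_integrable(1)) (use D elementary_square[OF el] in auto)
  define c where "c n = (\<integral>\<omega>. D n \<omega> * Z n \<omega> \<partial>M)" for n
  have "(\<integral>\<omega>. (F \<omega>)\<^sup>2 \<partial>M) = d n + 2 * c n + (norm (k n))\<^sup>2" for n
  proof -
    have "(\<integral>\<omega>. (1 * D n \<omega> + 1 * Z n \<omega>)\<^sup>2 \<partial>M) = 1\<^sup>2 * d n + 2 * 1 * 1 * c n + 1\<^sup>2 * (\<integral>\<omega>. (Z n \<omega>)\<^sup>2 \<partial>M)"
      unfolding d_def c_def by (rule L2_lincomb_integrable(2)) (use D elementary_square[OF el] in auto)
    then show ?thesis unfolding F[of _ n, symmetric] by (simp add: elementary_square(2)[OF el])
  qed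
  moreover have "c \<longlonglongrightarrow> 0"
  proof (rule Lim_null_comparison)
    show "eventually (\<lambda>n. norm (c n) \<le> sqrt (d n) * norm (k n)) sequentially"
    proof (intro always_eventually allI)
      fix n
      have "(c n)\<^sup>2 \<le> d n * (norm (k n))\<^sup>2"
        using L2_cauchy_schwarz[of "D n" M "Z n"] D[of n] elementary_square[OF el[of n]]
        unfolding c_def d_def by simp
      then have "\<bar>c n\<bar> \<le> sqrt (d n * (norm (k n))\<^sup>2)" by (intro real_le_rsqrt) simp
      then show "norm (c n) \<le> sqrt (d n) * norm (k n)" by (simp add: real_sqrt_mult)
    qed
    have "(\<lambda>n. sqrt (d n) * norm (k n)) \<longlonglongrightarrow> sqrt 0 * norm h" by (intro tendsto_intros d nk)
    then show "(\<lambda>n. sqrt (d n) * norm (k n)) \<longlonglongrightarrow> 0" by simp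
  qed
  moreover have "(\<lambda>n. d n + 2 * c n + (norm (k n))\<^sup>2) \<longlonglongrightarrow> 0 + 2 * 0 + (norm h)\<^sup>2"
    using calculation(2) by (intro tendsto_intros d nk)
  ultimately have "(\<lambda>n::nat. \<integral>\<omega>. (F \<omega>)\<^sup>2 \<partial>M) \<longlonglongrightarrow> (norm h)\<^sup>2" by simp
  then show "(\<integral>\<omega>. (F \<omega>)\<^sup>2 \<partial>M) = (norm h)\<^sup>2" using LIMSEQ_unique tendsto_const by blast
  have "(\<lambda>n. (CLINT \<omega>|M. iexp (F \<omega>)) - (CLINT \<omega>|M. iexp (Z n \<omega>))) \<longlonglongrightarrow> 0"
  proof (rule Lim_null_comparison)
    show "eventually (\<lambda>n. norm ((CLINT \<omega>|M. iexp (F \<omega>)) - (CLINT \<omega>|M. iexp (Z n \<omega>))) \<le> sqrt (d n)) sequentially"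
      unfolding d_def D_def by (intro always_eventually allI iexp_L2_dist int) auto
    show "(\<lambda>n. sqrt (d n)) \<longlonglongrightarrow> 0" using tendsto_real_sqrt[OF d] by simp
  qed
  from tendsto_diff[OF tendsto_const this, of "CLINT \<omega>|M. iexp (F \<omega>)"]
  have "(\<lambda>n. CLINT \<omega>|M. iexp (Z n \<omega>)) \<longlonglongrightarrow> (CLINT \<omega>|M. iexp (F \<omega>))" by simp
  moreover have "(\<lambda>n. complex_of_real (exp (- (norm (k n))\<^sup>2 / 2))) \<longlonglongrightarrow> complex_of_real (exp (- (norm h)\<^sup>2 / 2))"
    by (intro tendsto_of_real tendsto_exp tendsto_divide tendsto_minus tendsto_power nk tendsto_const) simp
  ultimately show "(CLINT \<omega>|M. iexp (F \<omega>)) = exp (- (norm h)\<^sup>2 / 2)"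
    unfolding elementary_char[OF el] by (rule LIMSEQ_unique)
qed

lemma chaos_rep_lincomb:
  assumes "chaos_rep h F" "chaos_rep h' F'"
  shows "chaos_rep (a *\<^sub>R h + b *\<^sub>R h') (\<lambda>\<omega>. a * F \<omega> + b * F' \<omega>)"
proof -
  obtain k Z where [measurable]: "F \<in> borel_measurable M" and el: "\<And>n. elementary T (k n) (Z n)" and k: "k \<longlonglongrightarrow> h"
    and int: "\<And>n. integrable M (\<lambda>\<omega>. (F \<omega> - Z n \<omega>)\<^sup>2)"
    and lim: "(\<lambda>n. \<integral>\<omega>. (F \<omega> - Z n \<omega>)\<^sup>2 \<partial>M) \<longlonglongrightarrow> 0"
    using assms(1) unfolding chaos_rep_def by auto
  obtain k' Z' where [measurable]: "F' \<in> borel_measurable M" and el': "\<And>n. elementary T (k' n) (Z' n)" and k': "k' \<longlonglongrightarrow> h'"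
    and int': "\<And>n. integrable M (\<lambda>\<omega>. (F' \<omega> - Z' n \<omega>)\<^sup>2)"
    and lim': "(\<lambda>n. \<integral>\<omega>. (F' \<omega> - Z' n \<omega>)\<^sup>2 \<partial>M) \<longlonglongrightarrow> 0"
    using assms(2) unfolding chaos_rep_def by auto
  have [measurable]: "Z n \<in> borel_measurable M" "Z' n \<in> borel_measurable M" for n
    using elementary_measurable el el' by auto
  let ?k = "\<lambda>n. a *\<^sub>R k n + b *\<^sub>R k' n" and ?Z = "\<lambda>n \<omega>. a * Z n \<omega> + b * Z' n \<omega>"
  have eq: "a * F \<omega> + b * F' \<omega> - ?Z n \<omega> = a * (F \<omega> - Z n \<omega>) + b * (F' \<omega> - Z' n \<omega>)" for n \<omega>
    by (simp add: algebra_simps)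
  have i: "integrable M (\<lambda>\<omega>. (a * F \<omega> + b * F' \<omega> - ?Z n \<omega>)\<^sup>2)" for n
    unfolding eq using int int' by (intro L2_lincomb_integrable) auto
  have le: "(\<integral>\<omega>. (a * F \<omega> + b * F' \<omega> - ?Z n \<omega>)\<^sup>2 \<partial>M)
      \<le> 2 * a\<^sup>2 * (\<integral>\<omega>. (F \<omega> - Z n \<omega>)\<^sup>2 \<partial>M) + 2 * b\<^sup>2 * (\<integral>\<omega>. (F' \<omega> - Z' n \<omega>)\<^sup>2 \<partial>M)" for n
  proof -
    have "(\<integral>\<omega>. (a * F \<omega> + b * F' \<omega> - ?Z n \<omega>)\<^sup>2 \<partial>M)
      \<le> (\<integral>\<omega>. 2 * a\<^sup>2 * (F \<omega> - Z n \<omega>)\<^sup>2 + 2 * b\<^sup>2 * (F' \<omega> - Z' n \<omega>)\<^sup>2 \<partial>M)"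
    proof (rule integral_mono[OF i])
      fix \<omega>
      have "(x + y)\<^sup>2 \<le> 2 * x\<^sup>2 + 2 * y\<^sup>2" for x y :: real
        using zero_le_power2[of "x - y"] by (simp add: power2_eq_square algebra_simps)
      from this[of "a * (F \<omega> - Z n \<omega>)" "b * (F' \<omega> - Z' n \<omega>)"]
      show "(a * F \<omega> + b * F' \<omega> - ?Z n \<omega>)\<^sup>2 \<le> 2 * a\<^sup>2 * (F \<omega> - Z n \<omega>)\<^sup>2 + 2 * b\<^sup>2 * (F' \<omega> - Z' n \<omega>)\<^sup>2"
        unfolding eq by (simp add: power_mult_distrib)
    qed (use int int' in auto)
    then show ?thesis using int int' by simp
  qed
  have "(\<lambda>n. \<integral>\<omega>. (a * F \<omega> + b * F' \<omega> - ?Z n \<omega>)\<^sup>2 \<partial>M) \<longlonglongrightarrow> 0"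
  proof (rule Lim_null_comparison)
    have "(\<lambda>n. 2 * a\<^sup>2 * (\<integral>\<omega>. (F \<omega> - Z n \<omega>)\<^sup>2 \<partial>M) + 2 * b\<^sup>2 * (\<integral>\<omega>. (F' \<omega> - Z' n \<omega>)\<^sup>2 \<partial>M))
      \<longlonglongrightarrow> 2 * a\<^sup>2 * 0 + 2 * b\<^sup>2 * 0" by (intro tendsto_intros lim lim')
    then show "(\<lambda>n. 2 * a\<^sup>2 * (\<integral>\<omega>. (F \<omega> - Z n \<omega>)\<^sup>2 \<partial>M) + 2 * b\<^sup>2 * (\<integral>\<omega>. (F' \<omega> - Z' n \<omega>)\<^sup>2 \<partial>M))
      \<longlonglongrightarrow> 0" by simp
  qed (use le in auto)
  moreover have "elementary T (?k n) (?Z n)" for n by (rule elementary_lincomb[OF el el'])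
  moreover have "?k \<longlonglongrightarrow> a *\<^sub>R h + b *\<^sub>R h'" by (intro tendsto_intros k k')
  ultimately show ?thesis unfolding chaos_rep_def using i
    by (intro conjI exI[of _ ?k] exI[of _ ?Z]) auto
qed

lemma chaos_rep_unique:
  assumes "chaos_rep h F" "chaos_rep h F'"
  shows "AE \<omega> in M. F \<omega> = F' \<omega>"
proof -
  have "chaos_rep 0 (\<lambda>\<omega>. F \<omega> - F' \<omega>)" using chaos_rep_lincomb[OF assms, of 1 "-1"] by simp
  note * = chaos_rep_square[OF this]
  have "AE \<omega> in M. (F \<omega> - F' \<omega>)\<^sup>2 = 0"
    using *(2) integral_nonneg_eq_0_iff_AE[OF *(1)] by simp
  then show ?thesis by auto
qed

text \<open>
  Stated for every horizon \<open>r\<close>: for \<open>r = T\<close> it gives the Wiener integral, for smaller \<open>r\<close> a version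
  that is measurable at time \<open>r\<close> exactly, not just up to null sets.
\<close>

lemma chaos_rep_exists:
  assumes h: "h \<in> closure (span (\<e> ` {0..r}))" and r: "r \<le> T"
  shows "\<exists>F\<in>borel_measurable (generated_filtration M X r). chaos_rep h F"
proof -
  have "\<exists>k Z. elementary r k Z \<and> norm (k - h) < (1/2)^n / 2" for n :: nat
  proof -
    obtain k where "k \<in> span (\<e> ` {0..r})" "dist k h < (1/2)^n / 2"
      using h unfolding closure_approachable by (metis half_gt_zero zero_less_power zero_less_divide_1_iff zero_less_numeral)
    then show ?thesis using elementary_exists[of k r] by (auto simp: dist_norm)
  qed
  then obtain k Z where el: "\<And>n::nat. elementary r (k n) (Z n)" and k: "\<And>n. norm (k n - h) < (1/2)^n / 2"
    by metis
  have elT: "elementary T (k n) (Z n)" for n using elementary_mono[OF el r] .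
  have diff: "elementary T (k m - k n) (\<lambda>\<omega>. Z m \<omega> - Z n \<omega>)" for m n
    using elementary_lincomb[OF elT elT, of 1 m "-1" n] by simp
  obtain F where F: "F \<in> borel_measurable (generated_filtration M X r)"
    "\<And>n. integrable M (\<lambda>\<omega>. (F \<omega> - Z n \<omega>)\<^sup>2)" "\<And>n. (\<integral>\<omega>. (F \<omega> - Z n \<omega>)\<^sup>2 \<partial>M) \<le> (1/4) ^ n"
  proof (rule L2_complete[OF subalgebra_filtration[OF r] elementary_adapted[OF el]])
    fix n m :: nat assume "n \<le> m"
    show "integrable M (\<lambda>\<omega>. (Z m \<omega> - Z n \<omega>)\<^sup>2)" by (rule elementary_square(1)[OF diff])
    have "norm (k m - k n) \<le> norm (k m - h) + norm (k n - h)"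
      using norm_triangle_ineq4[of "k m - h" "k n - h"] by simp
    also have "\<dots> \<le> (1/2)^m / 2 + (1/2)^n / 2" using k[of m] k[of n] by simp
    also have "\<dots> \<le> (1/2)^n" using power_decreasing[OF \<open>n \<le> m\<close>, of "1/2::real"] by linarith
    finally have "(norm (k m - k n))\<^sup>2 \<le> ((1/2)^n)\<^sup>2" by (intro power_mono) auto
    also have "\<dots> = (1/4) ^ n" by (simp add: power2_eq_square power_mult_distrib[symmetric])
    finally show "(\<integral>\<omega>. (Z m \<omega> - Z n \<omega>)\<^sup>2 \<partial>M) \<le> (1/4) ^ n" unfolding elementary_square(2)[OF diff] .
  qed blast
  have "(\<lambda>n. \<integral>\<omega>. (F \<omega> - Z n \<omega>)\<^sup>2 \<partial>M) \<longlonglongrightarrow> 0"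
    by (rule Lim_null_comparison[of _ "\<lambda>n. (1/4)^n"]) (use F(3) in \<open>auto intro: LIMSEQ_power_zero\<close>)
  moreover have "k \<longlonglongrightarrow> h"
  proof (rule LIM_zero_cancel, rule Lim_null_comparison)
    show "eventually (\<lambda>n. norm (k n - h) \<le> (1/2)^n) sequentially"
    proof (intro always_eventually allI)
      fix n show "norm (k n - h) \<le> (1/2)^n"
        using k[of n] zero_le_power[of "1/2::real" n] by linarith
    qed
    show "(\<lambda>n. (1/2::real)^n) \<longlonglongrightarrow> 0" by (rule LIMSEQ_power_zero) simp
  qed
  ultimately have "chaos_rep h F"
    unfolding chaos_rep_def using elT F(2) measurable_from_subalg[OF subalgebra_filtration[OF r] F(1)] by blast
  with F(1) show ?thesis by blast
qed

lemma chaos_rep_\<e>: "t \<in> {0..T} \<Longrightarrow> chaos_rep (\<e> t) (X t)"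
  unfolding chaos_rep_def using X_measurable elementary_\<e>[of t T]
  by (intro conjI exI[of _ "\<lambda>_. \<e> t"] exI[of _ "\<lambda>_. X t"]) auto

text \<open>
  \<open>wiener_integral\<close> is a choice, so nothing is known about it before this.
\<close>

lemma wiener_integral_exists: "\<exists>I. is_wiener_integral M T X \<iota> I"
proof -
  have "\<exists>F. F \<in> borel_measurable (generated_filtration M X T) \<and> chaos_rep h F" for h
    using chaos_rep_exists[of h T] span_indicators_dense by auto
  then obtain I where meas: "\<And>h. I h \<in> borel_measurable (generated_filtration M X T)"
    and rep: "\<And>h. chaos_rep h (I h)" by metis
  have "I h \<in> first_chaos M T X" for h
    unfolding first_chaos_def L2X_def
  proof (intro CollectI conjI allI impI meas chaos_rep_square(1)[OF rep])
    fix \<epsilon> :: real assume "\<epsilon> > 0"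
    obtain k Z where el: "\<And>n. elementary T (k n) (Z n)"
      and lim: "(\<lambda>n. \<integral>\<omega>. (I h \<omega> - Z n \<omega>)\<^sup>2 \<partial>M) \<longlonglongrightarrow> 0"
      using rep[of h] unfolding chaos_rep_def by auto
    obtain n where "(\<integral>\<omega>. (I h \<omega> - Z n \<omega>)\<^sup>2 \<partial>M) < \<epsilon>"
      using order_tendstoD(2)[OF lim \<open>\<epsilon> > 0\<close>] eventually_sequentially by auto
    moreover obtain A a where "finite A" "A \<subseteq> {0..T}" "Z n = (\<lambda>\<omega>. \<Sum>t\<in>A. a t * X t \<omega>)"
      using el[of n] unfolding elementary_def by auto
    ultimately show "\<exists>A a. finite A \<and> A \<subseteq> {0..T} \<and> (\<integral>\<omega>. (I h \<omega> - (\<Sum>t\<in>A. a t * X t \<omega>))\<^sup>2 \<partial>M) < \<epsilon>"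
      by auto
  qed
  moreover have "AE \<omega> in M. I (a *\<^sub>R h + b *\<^sub>R k) \<omega> = a * I h \<omega> + b * I k \<omega>" for a b h k
    by (rule chaos_rep_unique[OF rep chaos_rep_lincomb[OF rep rep]])
  moreover have "AE \<omega> in M. I (\<e> t) \<omega> = X t \<omega>" if "t \<in> {0..T}" for t
    by (rule chaos_rep_unique[OF rep chaos_rep_\<e>[OF that]])
  ultimately have "is_wiener_integral M T X \<iota> I"
    unfolding is_wiener_integral_def by (intro conjI allI ballI chaos_rep_square(2)[OF rep])
  then show ?thesis by blast
qed

abbreviation I :: "'h \<Rightarrow> 'a \<Rightarrow> real" where "I \<equiv> wiener_integral M T X \<iota>"

lemma is_wiener_integral_I: "is_wiener_integral M T X \<iota> I"
  unfolding wiener_integral_def using wiener_integral_exists by (rule someI_ex)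

lemma I_L2X: "I h \<in> L2X M T X"
  using is_wiener_integral_I unfolding is_wiener_integral_def first_chaos_def by simp

lemma I_adapted: "I h \<in> borel_measurable (generated_filtration M X T)"
  and I_square_integrable: "integrable M (\<lambda>\<omega>. (I h \<omega>)\<^sup>2)"
  using I_L2X[of h] by (simp_all add: L2X_def)

lemma I_isometry: "(\<integral>\<omega>. (I h \<omega>)\<^sup>2 \<partial>M) = (norm h)\<^sup>2"
  using is_wiener_integral_I unfolding is_wiener_integral_def by simp

lemma I_lin: "AE \<omega> in M. I (a *\<^sub>R h + b *\<^sub>R k) \<omega> = a * I h \<omega> + b * I k \<omega>"
  using is_wiener_integral_I unfolding is_wiener_integral_def by simp

lemma I_\<e>: "t \<in> {0..T} \<Longrightarrow> AE \<omega> in M. I (\<e> t) \<omega> = X t \<omega>"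
  using is_wiener_integral_I unfolding is_wiener_integral_def by simp

lemma I_meas [measurable]: "I h \<in> borel_measurable M"
  using measurable_from_subalg[OF subalgebra_filtration I_adapted] by simp

lemma I_elementary:
  assumes "elementary T k Z"
  shows "AE \<omega> in M. I k \<omega> = Z \<omega>"
proof -
  obtain A a where A: "finite A" "A \<subseteq> {0..T}" "k = (\<Sum>t\<in>A. a t *\<^sub>R \<e> t)" "Z = (\<lambda>\<omega>. \<Sum>t\<in>A. a t * X t \<omega>)"
    using assms unfolding elementary_def by auto
  have "AE \<omega> in M. \<forall>t\<in>A. I (\<e> t) \<omega> = X t \<omega>" using I_\<e> A by (intro AE_finite_allI) auto
  with AE_linear_sum[where I = I, OF I_lin A(1), of a \<e>] show ?thesis
    unfolding A(3,4) by eventually_elim simp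
qed

text \<open>
  The characterising properties alone force the chosen integral to be a version in the above
  sense, and thereby Gaussian.
\<close>

lemma chaos_rep_I: "chaos_rep h (I h)"
proof -
  obtain F k Z where el: "\<And>n. elementary T (k n) (Z n)" and k: "k \<longlonglongrightarrow> h"
    using chaos_rep_exists[of h T] span_indicators_dense unfolding chaos_rep_def by auto
  have [measurable]: "Z n \<in> borel_measurable M" for n using elementary_measurable[OF el] .
  have ae: "AE \<omega> in M. (I h \<omega> - Z n \<omega>)\<^sup>2 = (I (h - k n) \<omega>)\<^sup>2" for n
    using I_elementary[OF el[of n]] I_lin[of 1 h "-1" "k n"] by eventually_elim simp
  have "integrable M (\<lambda>\<omega>. (I h \<omega> - Z n \<omega>)\<^sup>2) \<longleftrightarrow> integrable M (\<lambda>\<omega>. (I (h - k n) \<omega>)\<^sup>2)" for n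
    by (rule integrable_cong_AE[OF _ _ ae]) auto
  then have i: "integrable M (\<lambda>\<omega>. (I h \<omega> - Z n \<omega>)\<^sup>2)" for n using I_square_integrable by simp
  have "(\<integral>\<omega>. (I h \<omega> - Z n \<omega>)\<^sup>2 \<partial>M) = (norm (h - k n))\<^sup>2" for n
    unfolding I_isometry[symmetric] by (rule integral_cong_AE[OF _ _ ae]) auto
  moreover have "(\<lambda>n. (norm (h - k n))\<^sup>2) \<longlonglongrightarrow> (norm (h - h))\<^sup>2" by (intro tendsto_intros k)
  ultimately show ?thesis unfolding chaos_rep_def using el k i
    by (intro conjI exI[of _ k] exI[of _ Z]) auto
qed

sublocale isonormal M I
  by unfold_locales (use I_lin chaos_rep_square(3)[OF chaos_rep_I] in auto)

lemma I_version:
  assumes "h \<in> closure (span (\<e> ` {0..r}))" "r \<le> T"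
  obtains Y where "Y \<in> borel_measurable (generated_filtration M X r)" "AE \<omega> in M. Y \<omega> = I h \<omega>"
  using chaos_rep_exists[OF assms] chaos_rep_unique[OF _ chaos_rep_I] by blast

end

section \<open>Wick exponentials and growth of transforms\<close>

context isonormal
begin

lemma exp_I_lincomb:
  shows "integrable M (\<lambda>\<omega>. exp (a * I h \<omega> + b * I k \<omega> + c))"
    and "(\<integral>\<omega>. exp (a * I h \<omega> + b * I k \<omega> + c) \<partial>M) = exp ((norm (a *\<^sub>R h + b *\<^sub>R k))\<^sup>2 / 2 + c)"
proof -
  have ae: "AE \<omega> in M. exp (a * I h \<omega> + b * I k \<omega> + c) = exp c * exp (I (a *\<^sub>R h + b *\<^sub>R k) \<omega>)"
    using I_linear[of a h b k] by eventually_elim (simp add: exp_add[symmetric] add.commute)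
  have "integrable M (\<lambda>\<omega>. exp (a * I h \<omega> + b * I k \<omega> + c))
      \<longleftrightarrow> integrable M (\<lambda>\<omega>. exp c * exp (I (a *\<^sub>R h + b *\<^sub>R k) \<omega>))"
    by (rule integrable_cong_AE[OF _ _ ae]) auto
  then show "integrable M (\<lambda>\<omega>. exp (a * I h \<omega> + b * I k \<omega> + c))"
    using integrable_exp_I by simp
  have "(\<integral>\<omega>. exp (a * I h \<omega> + b * I k \<omega> + c) \<partial>M) = (\<integral>\<omega>. exp c * exp (I (a *\<^sub>R h + b *\<^sub>R k) \<omega>) \<partial>M)"
    by (rule integral_cong_AE[OF _ _ ae]) auto
  then show "(\<integral>\<omega>. exp (a * I h \<omega> + b * I k \<omega> + c) \<partial>M) = exp ((norm (a *\<^sub>R h + b *\<^sub>R k))\<^sup>2 / 2 + c)"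
    by (simp add: integral_exp_I exp_add)
qed

lemma wick_square:
  shows "integrable M (\<lambda>\<omega>. (exp (I h \<omega> - (norm h)\<^sup>2 / 2))\<^sup>2)"
    and "(\<integral>\<omega>. (exp (I h \<omega> - (norm h)\<^sup>2 / 2))\<^sup>2 \<partial>M) = exp ((norm h)\<^sup>2)"
proof -
  have eq: "(exp (I h \<omega> - (norm h)\<^sup>2 / 2))\<^sup>2 = exp (2 * I h \<omega> + 0 * I 0 \<omega> + (- (norm h)\<^sup>2))" for \<omega>
    by (simp add: power2_eq_square exp_add[symmetric])
  show "integrable M (\<lambda>\<omega>. (exp (I h \<omega> - (norm h)\<^sup>2 / 2))\<^sup>2)"
    unfolding eq by (rule exp_I_lincomb)
  show "(\<integral>\<omega>. (exp (I h \<omega> - (norm h)\<^sup>2 / 2))\<^sup>2 \<partial>M) = exp ((norm h)\<^sup>2)"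
    unfolding eq exp_I_lincomb by (simp add: power_mult_distrib)
qed

lemma wick_mult_integrable:
  assumes "\<xi> \<in> borel_measurable M" "integrable M (\<lambda>\<omega>. (\<xi> \<omega>)\<^sup>2)"
  shows "integrable M (\<lambda>\<omega>. \<xi> \<omega> * exp (I h \<omega> - (norm h)\<^sup>2 / 2))"
  using assms wick_square(1) by (intro L2_mult_integrable) auto

text \<open>
  The exponentials have second moments \<open>exp (-2n)\<close>, so the sum of their squares is integrable; its
  square root dominates each of them.
\<close>

lemma L2_dominating_exponentials:
  assumes sub: "subalgebra M G" and G: "I g \<in> borel_measurable G"
  obtains \<xi> where "\<xi> \<in> borel_measurable G" "integrable M (\<lambda>\<omega>. (\<xi> \<omega>)\<^sup>2)"
    "\<And>n::nat. AE \<omega> in M. exp (real n * I g \<omega> - (real n)\<^sup>2 * (norm g)\<^sup>2 - real n) \<le> \<xi> \<omega>"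
proof -
  define v where "v n \<omega> = exp (real n * I g \<omega> - (real n)\<^sup>2 * (norm g)\<^sup>2 - real n)" for n \<omega>
  have v_G: "v n \<in> borel_measurable G" for n unfolding v_def using G by simp
  then have [measurable]: "v n \<in> borel_measurable M" for n by (rule measurable_from_subalg[OF sub])
  have v2: "(v n \<omega>)\<^sup>2 = exp ((2 * real n) * I g \<omega> + 0 * I g \<omega> + (- 2 * (real n)\<^sup>2 * (norm g)\<^sup>2 - 2 * real n))" for n \<omega>
    unfolding v_def by (simp add: power2_eq_square exp_add[symmetric])
  have v2_int: "integrable M (\<lambda>\<omega>. (v n \<omega>)\<^sup>2)" for n
    unfolding v2 by (rule exp_I_lincomb)
  have v2_E: "(\<integral>\<omega>. (v n \<omega>)\<^sup>2 \<partial>M) = (exp (- 2)) ^ n" for n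
    unfolding v2 exp_I_lincomb by (simp add: power_mult_distrib exp_of_nat_mult[symmetric])
  define S where "S \<omega> = (\<Sum>n. ennreal ((v n \<omega>)\<^sup>2))" for \<omega>
  have S_G: "S \<in> borel_measurable G" unfolding S_def
    by (intro borel_measurable_suminf_order measurable_compose[OF _ measurable_ennreal] borel_measurable_power v_G)
  then have [measurable]: "S \<in> borel_measurable M" by (rule measurable_from_subalg[OF sub])
  have "(\<integral>\<^sup>+\<omega>. S \<omega> \<partial>M) = (\<Sum>n. \<integral>\<^sup>+\<omega>. ennreal ((v n \<omega>)\<^sup>2) \<partial>M)"
    unfolding S_def by (rule nn_integral_suminf) simp
  also have "\<dots> = (\<Sum>n. ennreal (exp (- 2) ^ n))"
    by (subst nn_integral_eq_integral[OF v2_int]) (auto simp: v2_E)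
  also have "\<dots> = ennreal (\<Sum>n. exp (- 2) ^ n)"
    by (intro suminf_ennreal2) (auto intro: summable_geometric)
  finally have S_int: "(\<integral>\<^sup>+\<omega>. S \<omega> \<partial>M) < \<infinity>" by simp
  then have S_fin: "AE \<omega> in M. S \<omega> \<noteq> \<infinity>" by (intro nn_integral_PInf_AE) auto
  define \<xi> where "\<xi> \<omega> = sqrt (enn2real (S \<omega>))" for \<omega>
  have "(\<lambda>x. sqrt (enn2real x)) \<in> borel_measurable borel" by measurable
  from measurable_compose[OF S_G this] have \<xi>_G: "\<xi> \<in> borel_measurable G" unfolding \<xi>_def .
  then have [measurable]: "\<xi> \<in> borel_measurable M" by (rule measurable_from_subalg[OF sub])
  have "integrable M (\<lambda>\<omega>. (\<xi> \<omega>)\<^sup>2)"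
  proof (rule integrableI_bounded)
    have "(\<integral>\<^sup>+\<omega>. ennreal (norm ((\<xi> \<omega>)\<^sup>2)) \<partial>M) = (\<integral>\<^sup>+\<omega>. S \<omega> \<partial>M)"
      using S_fin by (intro nn_integral_cong_AE) (auto simp: \<xi>_def less_top)
    then show "(\<integral>\<^sup>+\<omega>. ennreal (norm ((\<xi> \<omega>)\<^sup>2)) \<partial>M) < \<infinity>" using S_int by simp
  qed simp
  moreover have "AE \<omega> in M. v n \<omega> \<le> \<xi> \<omega>" for n
    using S_fin
  proof eventually_elim
    case (elim \<omega>)
    have "ennreal ((v n \<omega>)\<^sup>2) \<le> S \<omega>"
    proof -
      have "(\<Sum>i\<in>{n}. ennreal ((v i \<omega>)\<^sup>2)) \<le> (\<Sum>i. ennreal ((v i \<omega>)\<^sup>2))"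
        by (rule sum_le_suminf) (auto intro: summableI)
      then show ?thesis unfolding S_def by (simp only: sum.insert_remove sum.empty finite.emptyI empty_Diff add_0_right)
    qed
    then have "enn2real (ennreal ((v n \<omega>)\<^sup>2)) \<le> enn2real (S \<omega>)"
      using elim by (intro enn2real_mono) (auto simp: less_top)
    then show ?case unfolding \<xi>_def by (intro real_le_rsqrt) simp
  qed
  ultimately show ?thesis using that \<xi>_G unfolding v_def by blast
qed

text \<open>
  With \<open>h = n u\<close>, the left transform is at least \<open>exp (n\<^sup>2 (|u|\<^sup>2 - |g|\<^sup>2/2) + n (d - 1))\<close>; the
  right one is at most a multiple of \<open>exp (n\<^sup>2 |u|\<^sup>2/2)\<close> by the Cauchy-Schwarz inequality. Comparing
  the coefficients of \<open>n\<^sup>2\<close> gives the claim.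
\<close>

lemma norm_le_of_transform_growth:
  assumes \<xi>: "\<xi> \<in> borel_measurable M" "integrable M (\<lambda>\<omega>. (\<xi> \<omega>)\<^sup>2)"
      "\<And>n::nat. AE \<omega> in M. exp (real n * I g \<omega> - (real n)\<^sup>2 * (norm g)\<^sup>2 - real n) \<le> \<xi> \<omega>"
    and \<eta>: "\<eta> \<in> borel_measurable M" "integrable M (\<lambda>\<omega>. (\<eta> \<omega>)\<^sup>2)"
    and k: "\<And>h. inner g (k h) = inner u h + d"
    and eq: "\<And>h. (\<integral>\<omega>. \<xi> \<omega> * exp (I (k h) \<omega> - (norm (k h))\<^sup>2 / 2) \<partial>M)
      = (\<integral>\<omega>. \<eta> \<omega> * exp (I h \<omega> - (norm h)\<^sup>2 / 2) \<partial>M)"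
  shows "norm u \<le> norm g"
proof (rule ccontr)
  assume "\<not> norm u \<le> norm g"
  then have pos: "(norm u)\<^sup>2 - (norm g)\<^sup>2 > 0" using power_strict_mono[of "norm g" "norm u" 2] by simp
  define U G where "U = (norm u)\<^sup>2" and "G = (norm g)\<^sup>2"
  \<comment> \<open>the summand 1 keeps \<open>ln C\<close> meaningful when \<open>\<eta>\<close> vanishes\<close>
  define C where "C = sqrt (\<integral>\<omega>. (\<eta> \<omega>)\<^sup>2 \<partial>M) + 1"
  have C: "C > 0" unfolding C_def by (simp add: add_nonneg_pos)
  have main: "real n * (real n * ((U - G) / 2) + (d - 1)) \<le> ln C" for n :: nat
  proof -
    define h where "h = real n *\<^sub>R u"
    define K where "K = (norm (k h))\<^sup>2"
    have gk: "inner g (k h) = real n * U + d" by (simp add: k h_def U_def power2_norm_eq_inner)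
    have v_eq: "exp (real n * I g \<omega> - (real n)\<^sup>2 * G - real n) * exp (I (k h) \<omega> - K / 2)
        = exp (real n * I g \<omega> + 1 * I (k h) \<omega> + (- (real n)\<^sup>2 * G - real n - K / 2))" for \<omega>
      by (simp add: exp_add[symmetric])
    have nrm: "(norm (real n *\<^sub>R g + 1 *\<^sub>R k h))\<^sup>2 = (real n)\<^sup>2 * G + 2 * real n * (real n * U + d) + K"
      unfolding gk[symmetric] G_def K_def power2_norm_eq_inner
      by (simp add: inner_simps inner_commute power2_eq_square algebra_simps)
    have "exp ((real n)\<^sup>2 * (U - G / 2) + real n * (d - 1))
        = exp ((norm (real n *\<^sub>R g + 1 *\<^sub>R k h))\<^sup>2 / 2 + (- (real n)\<^sup>2 * G - real n - K / 2))"
      unfolding nrm by (simp add: power2_eq_square field_simps)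
    also have "\<dots> = (\<integral>\<omega>. exp (real n * I g \<omega> - (real n)\<^sup>2 * G - real n) * exp (I (k h) \<omega> - K / 2) \<partial>M)"
      unfolding v_eq exp_I_lincomb by simp
    also have "\<dots> \<le> (\<integral>\<omega>. \<xi> \<omega> * exp (I (k h) \<omega> - K / 2) \<partial>M)"
    proof (rule integral_mono_AE)
      show "integrable M (\<lambda>\<omega>. exp (real n * I g \<omega> - (real n)\<^sup>2 * G - real n) * exp (I (k h) \<omega> - K / 2))"
        unfolding v_eq by (rule exp_I_lincomb)
      show "integrable M (\<lambda>\<omega>. \<xi> \<omega> * exp (I (k h) \<omega> - K / 2))"
        unfolding K_def by (rule wick_mult_integrable[OF \<xi>(1,2)])
      show "AE \<omega> in M. exp (real n * I g \<omega> - (real n)\<^sup>2 * G - real n) * exp (I (k h) \<omega> - K / 2)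
          \<le> \<xi> \<omega> * exp (I (k h) \<omega> - K / 2)"
        using \<xi>(3)[of n] unfolding G_def by eventually_elim (intro mult_right_mono, auto)
    qed
    also have "\<dots> = (\<integral>\<omega>. \<eta> \<omega> * exp (I h \<omega> - (norm h)\<^sup>2 / 2) \<partial>M)" unfolding K_def by (rule eq)
    also have "\<dots> \<le> sqrt ((\<integral>\<omega>. (\<eta> \<omega>)\<^sup>2 \<partial>M) * exp ((norm h)\<^sup>2))"
      using L2_cauchy_schwarz[OF \<eta>(1) _ \<eta>(2) wick_square(1)[of h]] wick_square(2)[of h]
      by (intro real_le_rsqrt) simp
    also have "\<dots> = sqrt (\<integral>\<omega>. (\<eta> \<omega>)\<^sup>2 \<partial>M) * exp ((real n)\<^sup>2 * U / 2)"
    proof -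
      have "sqrt (exp x) = exp (x / 2)" for x :: real
        by (rule real_sqrt_unique) (simp_all add: power2_eq_square exp_add[symmetric])
      then show ?thesis by (simp add: real_sqrt_mult h_def U_def power_mult_distrib)
    qed
    also have "\<dots> \<le> C * exp ((real n)\<^sup>2 * U / 2)"
      unfolding C_def by (intro mult_right_mono) auto
    finally have "(real n)\<^sup>2 * (U - G / 2) + real n * (d - 1) \<le> ln (C * exp ((real n)\<^sup>2 * U / 2))"
      using C by (subst ln_ge_iff) auto
    also have "\<dots> = ln C + (real n)\<^sup>2 * U / 2" using C by (simp add: ln_mult)
    finally show ?thesis by (simp add: power2_eq_square field_simps)
  qed
  have UG: "(U - G) / 2 > 0" using pos by (simp add: U_def G_def)
  \<comment> \<open>the first bound makes the bracket in \<open>main\<close> at least 1, the second makes \<open>N\<close> exceed \<open>ln C\<close>\<close>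
  obtain N :: nat where N: "real N \<ge> max ((2 - d) / ((U - G) / 2)) (\<bar>ln C\<bar> + 1)"
    using real_arch_simple by blast
  then have "(2 - d) / ((U - G) / 2) \<le> real N" by simp
  then have "2 - d \<le> real N * ((U - G) / 2)" using UG by (simp only: pos_divide_le_eq)
  then have "1 \<le> real N * ((U - G) / 2) + (d - 1)" by simp
  then have "real N * 1 \<le> real N * (real N * ((U - G) / 2) + (d - 1))" by (intro mult_left_mono) auto
  also have "\<dots> \<le> ln C" by (rule main)
  finally show False using N by simp
qed

end

section \<open>Restriction operators and the martingale property\<close>

context gaussian_setting
begin

text \<open>
  The span of the indicators is dense, so operator identities need checking only there.
\<close>

lemma bounded_linear_eqI:
  fixes f g :: "'h \<Rightarrow> 'c::real_normed_vector"
  assumes f: "bounded_linear f" and g: "bounded_linear g" and eq: "\<And>t. t \<in> {0..T} \<Longrightarrow> f (\<e> t) = g (\<e> t)"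
  shows "f = g"
proof
  fix x
  interpret f: bounded_linear f by fact
  interpret g: bounded_linear g by fact
  have "closed {x. f x = g x}"
    by (intro closed_Collect_eq linear_continuous_on f g)
  moreover have "span (\<e> ` {0..T}) \<subseteq> {x. f x = g x}"
    by (intro span_minimal subspaceI) (auto simp: eq f.add g.add f.scaleR g.scaleR f.zero g.zero)
  ultimately have "closure (span (\<e> ` {0..T})) \<subseteq> {x. f x = g x}" by (intro closure_minimal)
  then show "f x = g x" unfolding span_indicators_dense by auto
qed

lemma is_restriction_op_restriction_op:
  assumes ex: "has_indefinite_wiener_integral T \<iota>" and r: "r \<in> {0..T}"
  shows "is_restriction_op T \<iota> r (restriction_op T \<iota> r)"
proof -
  obtain A where A: "is_restriction_op T \<iota> r A"
    using ex r unfolding has_indefinite_wiener_integral_def by blast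
  have "B = A" if "is_restriction_op T \<iota> r B" for B
    using that A unfolding is_restriction_op_def by (intro bounded_linear_eqI) auto
  with A show ?thesis unfolding restriction_op_def by (rule theI)
qed

lemma S_transform_eq: "S_transform M T X \<iota> \<xi> h = (\<integral>\<omega>. \<xi> \<omega> * exp (I h \<omega> - (norm h)\<^sup>2 / 2) \<partial>M)"
  unfolding S_transform_def wick_exp_def I_isometry by simp

lemma L2X_square_integrable:
  assumes "\<xi> \<in> L2X M T X"
  shows "\<xi> \<in> borel_measurable M" "integrable M (\<lambda>\<omega>. (\<xi> \<omega>)\<^sup>2)"
  using assms measurable_from_subalg[OF subalgebra_filtration[of T]] unfolding L2X_def by auto

lemma restriction_contraction:
  assumes ex: "has_indefinite_wiener_integral T \<iota>" and r: "r \<in> {0..T}"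
    and full: "L2X M T X \<subseteq> shifted_qce_domain M T X \<iota> r c"
  shows "norm (restriction_op T \<iota> r g) \<le> norm g"
proof -
  define A where "A = restriction_op T \<iota> r"
  have A: "bounded_linear A" using is_restriction_op_restriction_op[OF ex r] unfolding A_def is_restriction_op_def by simp
  obtain \<xi> where \<xi>: "\<xi> \<in> borel_measurable (generated_filtration M X T)" "integrable M (\<lambda>\<omega>. (\<xi> \<omega>)\<^sup>2)"
    "\<And>n::nat. AE \<omega> in M. exp (real n * I g \<omega> - (real n)\<^sup>2 * (norm g)\<^sup>2 - real n) \<le> \<xi> \<omega>"
    using L2_dominating_exponentials[OF subalgebra_filtration I_adapted] by auto
  then have "\<xi> \<in> L2X M T X" by (simp add: L2X_def)
  then obtain \<eta> where \<eta>: "\<eta> \<in> L2X M T X"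
    and eq: "\<And>h. S_transform M T X \<iota> \<xi> (stopped_integrand T \<iota> r (h + c) - c) = S_transform M T X \<iota> \<eta> h"
    using full unfolding shifted_qce_domain_def by blast
  have "norm (A g) \<le> norm g"
  proof (rule norm_le_of_transform_growth[OF L2X_square_integrable(1)[OF \<open>\<xi> \<in> L2X M T X\<close>] \<xi>(2,3) L2X_square_integrable[OF \<eta>]])
    fix h
    show "inner g (stopped_integrand T \<iota> r (h + c) - c) = inner (A g) h + (inner (A g) c - inner g c)"
      unfolding stopped_integrand_def A_def[symmetric] inner_diff_right adjoint_works_hilbert[OF A]
      by (simp add: inner_add_right)
    show "(\<integral>\<omega>. \<xi> \<omega> * exp (I (stopped_integrand T \<iota> r (h + c) - c) \<omega> - (norm (stopped_integrand T \<iota> r (h + c) - c))\<^sup>2 / 2) \<partial>M)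
      = (\<integral>\<omega>. \<eta> \<omega> * exp (I h \<omega> - (norm h)\<^sup>2 / 2) \<partial>M)"
      using eq[of h] unfolding S_transform_eq .
  qed
  then show ?thesis unfolding A_def .
qed

text \<open>
  \<open>A\<close> fixes \<open>e\<^sub>u\<close> and annihilates \<open>q = e\<^sub>t - e\<^sub>s\<close>, so \<open>|e\<^sub>u| \<le> |e\<^sub>u + x q|\<close> for every real \<open>x\<close>.
\<close>

lemma orthogonal_of_contraction:
  assumes "is_restriction_op T \<iota> s A" and contr: "\<And>g. norm (A g) \<le> norm g"
    and t: "0 \<le> u" "u \<le> s" "s \<le> t" "t \<le> T"
  shows "inner (\<e> t - \<e> s) (\<e> u) = 0"
proof -
  have A: "bounded_linear A" and Ae: "\<And>t. t \<in> {0..T} \<Longrightarrow> A (\<e> t) = \<e> (min t s)"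
    using assms(1) unfolding is_restriction_op_def by auto
  interpret A: bounded_linear A by fact
  define q where "q = \<e> t - \<e> s"
  have "A (\<e> u + x *\<^sub>R q) = \<e> u" for x
    using t by (simp add: q_def A.add A.scaleR A.diff Ae)
  then have *: "inner (\<e> u) (\<e> u) \<le> inner (\<e> u + x *\<^sub>R q) (\<e> u + x *\<^sub>R q)" for x
    using contr[of "\<e> u + x *\<^sub>R q"] unfolding norm_le by simp
  define b where "b = inner q (\<e> u)"
  have q: "0 \<le> 2 * x * b + x\<^sup>2 * inner q q" for x
    using *[of x] by (simp add: b_def inner_simps inner_commute power2_eq_square algebra_simps)
  have "b = 0" by (rule quadratic_nonneg_linear_zero[OF q]) simp
  then show ?thesis by (simp add: b_def q_def)
qed

lemma expectation_mult_future:
  fixes f :: "real \<Rightarrow> real"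
  assumes r: "0 \<le> r" "r \<le> T" and orth: "\<And>s. s \<in> {0..r} \<Longrightarrow> inner q (\<e> s) = 0"
    and Z: "Z \<in> borel_measurable (generated_filtration M X r)" "integrable M Z"
    and f: "f \<in> borel_measurable borel" "integrable M (\<lambda>\<omega>. f (I q \<omega>))"
  shows "(\<integral>\<omega>. Z \<omega> * f (I q \<omega>) \<partial>M) = (\<integral>\<omega>. Z \<omega> \<partial>M) * (\<integral>\<omega>. f (I q \<omega>) \<partial>M)"
proof (rule expectation_mult_orthogonal[where S = "{0..r}" and X = X and v = \<e> and q = q and f = f and Z = Z])
  fix t assume t: "t \<in> {0..r}"
  then have t': "t \<in> {0..T}" using r by simp
  show "X t \<in> borel_measurable M" by (rule X_measurable[OF t'])
  show "AE \<omega> in M. X t \<omega> = I (\<e> t) \<omega>" using I_\<e>[OF t'] by eventually_elim simp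
  show "inner q (\<e> t) = 0" by (rule orth[OF t])
next
  show "Z \<in> borel_measurable (sigma (space M) (\<Union>s\<in>{0..r}. {X s -` B \<inter> space M | B. B \<in> sets borel}))"
    using Z(1) unfolding generated_filtration_def .
qed (fact f Z)+

lemma cond_exp_locale: "r \<le> T \<Longrightarrow> sigma_finite_subalgebra M (generated_filtration M X r)"
  by (intro finite_measure_subalgebra_is_sigma_finite)
     (simp add: finite_measure_subalgebra_def finite_measure_subalgebra_axioms_def finite_measure_axioms subalgebra_filtration)

text \<open>
  Being independent of the past and centered, the increment \<open>X\<^sub>t - X\<^sub>s\<close> integrates to zero over
  each event of time \<open>s\<close>.
\<close>

lemma martingale_of_orthogonal:
  assumes orth: "\<And>s t u. 0 \<le> u \<Longrightarrow> u \<le> s \<Longrightarrow> s \<le> t \<Longrightarrow> t \<le> T \<Longrightarrow> inner (\<e> t - \<e> s) (\<e> u) = 0"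
  shows "own_martingale M T X"
  unfolding own_martingale_def
proof (intro conjI ballI allI impI X_integrable)
  fix s t assume st: "0 \<le> s \<and> s \<le> t \<and> t \<le> T"
  let ?G = "generated_filtration M X s"
  interpret G: sigma_finite_subalgebra M ?G using cond_exp_locale st by simp
  have t: "t \<in> {0..T}" and s: "s \<in> {0..T}" using st by auto
  define q where "q = \<e> t - \<e> s"
  have q: "AE \<omega> in M. I q \<omega> = X t \<omega> - X s \<omega>"
    using I_diff[of "\<e> t" "\<e> s"] I_\<e>[OF t] I_\<e>[OF s] unfolding q_def by eventually_elim simp
  note [measurable] = X_measurable[OF t] X_measurable[OF s]
  have Iq_int: "integrable M (I q)"
    using L1_le_L2(1)[OF I_meas I_square_integrable] .
  have "(\<integral>\<omega>. I q \<omega> \<partial>M) = (\<integral>\<omega>. X t \<omega> - X s \<omega> \<partial>M)"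
    by (rule integral_cong_AE[OF _ _ q]) auto
  also have "\<dots> = 0"
    using centered s t unfolding centered_process_def by (simp add: X_integrable)
  finally have Eq: "(\<integral>\<omega>. I q \<omega> \<partial>M) = 0" .
  show "AE \<omega> in M. real_cond_exp M ?G (X t) \<omega> = X s \<omega>"
  proof (rule G.real_cond_exp_charact)
    show "X s \<in> borel_measurable ?G" using X_adapted st by auto
    fix A assume A: "A \<in> sets ?G"
    then have [measurable]: "A \<in> sets M" using G.subalg unfolding subalgebra_def by auto
    have "(\<integral>\<omega>. indicator A \<omega> * I q \<omega> \<partial>M) = (\<integral>\<omega>. indicator A \<omega> \<partial>M) * (\<integral>\<omega>. I q \<omega> \<partial>M)"
      by (rule expectation_mult_future[where r = s and f = "\<lambda>x. x"])
         (use st orth[of _ s t] A Iq_int in \<open>auto simp: q_def intro!: integrable_real_indicator simp: emeasure_eq_measure\<close>)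
    then have "(\<integral>\<omega>. indicator A \<omega> * I q \<omega> \<partial>M) = 0" using Eq by simp
    also have "(\<integral>\<omega>. indicator A \<omega> * I q \<omega> \<partial>M) = (\<integral>\<omega>. indicator A \<omega> * X t \<omega> - indicator A \<omega> * X s \<omega> \<partial>M)"
    proof (rule integral_cong_AE)
      show "AE \<omega> in M. indicator A \<omega> * I q \<omega> = indicator A \<omega> * X t \<omega> - indicator A \<omega> * X s \<omega>"
        using q by eventually_elim (simp add: right_diff_distrib)
    qed auto
    also have "\<dots> = (\<integral>\<omega>. indicator A \<omega> * X t \<omega> \<partial>M) - (\<integral>\<omega>. indicator A \<omega> * X s \<omega> \<partial>M)"
      using integrable_mult_indicator[of A M "X t"] integrable_mult_indicator[of A M "X s"]
        X_integrable[OF t] X_integrable[OF s] by simp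
    finally show "(\<integral>\<omega>\<in>A. X t \<omega> \<partial>M) = (\<integral>\<omega>\<in>A. X s \<omega> \<partial>M)"
      unfolding set_lebesgue_integral_def by simp
  qed (use s t X_integrable in auto)
qed

lemma inner_increment_of_martingale:
  assumes mart: "own_martingale M T X" and u: "0 \<le> u" "u \<le> s" "s \<le> t" "t \<le> T"
  shows "inner (\<e> t) (\<e> u) = inner (\<e> s) (\<e> u)"
proof -
  let ?G = "generated_filtration M X s"
  interpret G: sigma_finite_subalgebra M ?G using cond_exp_locale u by simp
  have m: "s \<in> {0..T}" "t \<in> {0..T}" "u \<in> {0..T}" using u by auto
  note [measurable] = m[THEN X_measurable]
  have "(\<integral>\<omega>. X u \<omega> * X t \<omega> \<partial>M) = (\<integral>\<omega>. X u \<omega> * real_cond_exp M ?G (X t) \<omega> \<partial>M)"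
    using m u by (intro G.real_cond_exp_intg(2)[symmetric] X_mult_integrable X_adapted) auto
  also have "\<dots> = (\<integral>\<omega>. X u \<omega> * X s \<omega> \<partial>M)"
  proof (rule integral_cong_AE)
    have "AE \<omega> in M. real_cond_exp M ?G (X t) \<omega> = X s \<omega>"
      using mart u unfolding own_martingale_def by auto
    then show "AE \<omega> in M. X u \<omega> * real_cond_exp M ?G (X t) \<omega> = X u \<omega> * X s \<omega>" by auto
  qed auto
  finally show ?thesis using m by (simp add: inner_\<e> inner_commute[of _ "\<e> u"])
qed

text \<open>
  The martingale property makes the covariance of \<open>X\<^sub>s\<close> and \<open>X\<^sub>t\<close> the variance at time \<open>min s t\<close>,
  whence the restriction operator is symmetric and equals its adjoint. The witness for \<open>\<xi>\<close> is its
  conditional expectation at time \<open>r\<close>.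
\<close>

lemma qce_domain_of_martingale:
  assumes ex: "has_indefinite_wiener_integral T \<iota>" and r: "r \<in> {0..T}"
    and mart: "own_martingale M T X"
  shows "L2X M T X \<subseteq> shifted_qce_domain M T X \<iota> r 0"
proof
  fix \<xi> assume \<xi>: "\<xi> \<in> L2X M T X"
  let ?G = "generated_filtration M X r"
  have rT: "0 \<le> r" "r \<le> T" using r by auto
  interpret G: sigma_finite_subalgebra M ?G using cond_exp_locale rT by simp
  define A where "A = restriction_op T \<iota> r"
  have A: "bounded_linear A" and Ae: "\<And>t. t \<in> {0..T} \<Longrightarrow> A (\<e> t) = \<e> (min t r)"
    using is_restriction_op_restriction_op[OF ex r] unfolding A_def is_restriction_op_def by auto
  interpret A: bounded_linear A by fact
  have inner_min: "inner (\<e> t) (\<e> s) = inner (\<e> (min t s)) (\<e> (min t s))"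
    if "t \<in> {0..T}" "s \<in> {0..T}" for s t
  proof (cases "s \<le> t")
    case True
    then show ?thesis using inner_increment_of_martingale[OF mart, of s s t] that by (simp add: min_absorb2)
  next
    case False
    then show ?thesis using inner_increment_of_martingale[OF mart, of t t s] that
      by (simp add: min_absorb1 inner_commute)
  qed
  have sa1: "inner (A x) (\<e> s) = inner x (A (\<e> s))" if s: "s \<in> {0..T}" for x s
  proof -
    have "(\<lambda>x. inner (A x) (\<e> s)) = (\<lambda>x. inner x (A (\<e> s)))"
    proof (rule bounded_linear_eqI)
      fix t assume t: "t \<in> {0..T}"
      show "inner (A (\<e> t)) (\<e> s) = inner (\<e> t) (A (\<e> s))"
        using s t r inner_min[of "min t r" s] inner_min[of t "min s r"]
        by (simp add: Ae min.assoc min.commute min.left_commute min.coboundedI2)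
    qed (intro bounded_linear_compose[OF bounded_linear_inner_left A] bounded_linear_inner_left)+
    then show ?thesis by meson
  qed
  have sa: "inner (A x) y = inner x (A y)" for x y
  proof -
    have "(\<lambda>y. inner (A x) y) = (\<lambda>y. inner x (A y))"
      using sa1 by (intro bounded_linear_eqI bounded_linear_compose[OF bounded_linear_inner_right A] bounded_linear_inner_right)
    then show ?thesis by meson
  qed
  then have adj: "adjoint A = A" by (intro adjoint_unique) auto
  have idem: "A (A x) = A x" for x
  proof -
    have "(\<lambda>x. A (A x)) = A"
      using r by (intro bounded_linear_eqI bounded_linear_compose[OF A A] A) (auto simp: Ae)
    then show ?thesis by (rule fun_cong)
  qed
  have range: "A h \<in> closure (span (\<e> ` {0..r}))" for h
  proof -
    have "A h \<in> A ` closure (span (\<e> ` {0..T}))" by (simp add: span_indicators_dense)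
    also have "\<dots> \<subseteq> closure (A ` span (\<e> ` {0..T}))" by (rule closure_bounded_linear_image_subset[OF A])
    also have "A ` span (\<e> ` {0..T}) = span (A ` \<e> ` {0..T})"
      by (rule linear_span_image[symmetric]) (rule A.linear_axioms)
    also have "closure \<dots> \<subseteq> closure (span (\<e> ` {0..r}))"
      using r by (intro closure_mono span_mono) (auto simp: Ae)
    finally show ?thesis .
  qed
  define \<eta> where "\<eta> = real_cond_exp M ?G \<xi>"
  note \<xi>_M [measurable] = L2X_square_integrable(1)[OF \<xi>] and \<xi>_sq = L2X_square_integrable(2)[OF \<xi>]
  have \<xi>_int: "integrable M \<xi>" using L1_le_L2(1)[OF \<xi>_M \<xi>_sq] .
  have \<eta>_G [measurable]: "\<eta> \<in> borel_measurable ?G" unfolding \<eta>_def by simp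
  have \<eta>_M [measurable]: "\<eta> \<in> borel_measurable M" unfolding \<eta>_def by simp
  have \<eta>_sq: "integrable M (\<lambda>\<omega>. (\<eta> \<omega>)\<^sup>2)"
    unfolding \<eta>_def
  proof (rule G.integrable_convex_cond_exp[where X = \<xi> and q = "\<lambda>x. x\<^sup>2" and I = UNIV])
    show "convex_on UNIV (\<lambda>x::real. x\<^sup>2)" by (rule convex_power2)
  qed (use \<xi>_int \<xi>_sq in auto)
  have "\<eta> \<in> L2X M T X"
    unfolding L2X_def using \<eta>_sq measurable_from_subalg[OF subalgebra_filtration_mono[OF rT(2)] \<eta>_G] by simp
  moreover have "S_transform M T X \<iota> \<xi> (stopped_integrand T \<iota> r (h + 0) - 0) = S_transform M T X \<iota> \<eta> h" for h
  proof -
    define p q where "p = A h" and "q = h - A h"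
    have orth: "inner q (\<e> s) = 0" if "s \<in> {0..r}" for s
      using that r by (simp add: q_def inner_diff_left sa Ae)
    have "inner p q = 0"
      unfolding p_def q_def inner_diff_right sa[of h] idem by simp
    moreover have h: "h = p + q" by (simp add: p_def q_def)
    ultimately have nrm: "(norm h)\<^sup>2 = (norm p)\<^sup>2 + (norm q)\<^sup>2"
      unfolding h power2_norm_eq_inner by (simp add: inner_add_left inner_add_right inner_commute)
    \<comment> \<open>\<open>I p\<close> itself is measurable at time \<open>r\<close> only up to a null set\<close>
    obtain Y where Y [measurable]: "Y \<in> borel_measurable ?G" and Yp: "AE \<omega> in M. Y \<omega> = I p \<omega>"
      using I_version[OF range rT(2)] unfolding p_def by metis
    have [measurable]: "Y \<in> borel_measurable M" by (rule measurable_from_subalg[OF G.subalg Y])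
    define e where "e \<omega> = exp (Y \<omega> - (norm p)\<^sup>2 / 2)" for \<omega>
    have e_G [measurable]: "e \<in> borel_measurable ?G" unfolding e_def by simp
    have [measurable]: "e \<in> borel_measurable M" unfolding e_def by simp
    have ep: "AE \<omega> in M. e \<omega> = exp (I p \<omega> - (norm p)\<^sup>2 / 2)" using Yp unfolding e_def by auto
    have e\<xi>: "integrable M (\<lambda>\<omega>. e \<omega> * \<xi> \<omega>)" and e\<eta>: "integrable M (\<lambda>\<omega>. \<eta> \<omega> * e \<omega>)"
    proof -
      have "integrable M (\<lambda>\<omega>. e \<omega> * \<xi> \<omega>) \<longleftrightarrow> integrable M (\<lambda>\<omega>. \<xi> \<omega> * exp (I p \<omega> - (norm p)\<^sup>2 / 2))"
        by (rule integrable_cong_AE) (use ep in auto)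
      then show "integrable M (\<lambda>\<omega>. e \<omega> * \<xi> \<omega>)" using wick_mult_integrable[OF \<xi>_M \<xi>_sq] by simp
      have "integrable M (\<lambda>\<omega>. \<eta> \<omega> * e \<omega>) \<longleftrightarrow> integrable M (\<lambda>\<omega>. \<eta> \<omega> * exp (I p \<omega> - (norm p)\<^sup>2 / 2))"
        by (rule integrable_cong_AE) (use ep in auto)
      then show "integrable M (\<lambda>\<omega>. \<eta> \<omega> * e \<omega>)" using wick_mult_integrable[OF \<eta>_M \<eta>_sq] by simp
    qed
    have q1: "integrable M (\<lambda>\<omega>. exp (I q \<omega> - (norm q)\<^sup>2 / 2))"
      "(\<integral>\<omega>. exp (I q \<omega> - (norm q)\<^sup>2 / 2) \<partial>M) = 1"
      using exp_I_lincomb[of 1 q 0 0 "- (norm q)\<^sup>2 / 2"] by simp_all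
    have "S_transform M T X \<iota> \<eta> h = (\<integral>\<omega>. (\<eta> \<omega> * e \<omega>) * exp (I q \<omega> - (norm q)\<^sup>2 / 2) \<partial>M)"
      unfolding S_transform_eq
    proof (rule integral_cong_AE)
      have "AE \<omega> in M. I h \<omega> = I p \<omega> + I q \<omega>"
        using I_add[of p q] unfolding h .
      with Yp show "AE \<omega> in M. \<eta> \<omega> * exp (I h \<omega> - (norm h)\<^sup>2 / 2)
          = (\<eta> \<omega> * e \<omega>) * exp (I q \<omega> - (norm q)\<^sup>2 / 2)"
      proof eventually_elim
        case (elim \<omega>)
        have "I h \<omega> - (norm h)\<^sup>2 / 2 = (Y \<omega> - (norm p)\<^sup>2 / 2) + (I q \<omega> - (norm q)\<^sup>2 / 2)"
          unfolding elim nrm by (simp add: field_simps)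
        then show ?case unfolding e_def by (simp only: exp_add mult.assoc)
      qed
    qed auto
    also have "\<dots> = (\<integral>\<omega>. \<eta> \<omega> * e \<omega> \<partial>M) * (\<integral>\<omega>. exp (I q \<omega> - (norm q)\<^sup>2 / 2) \<partial>M)"
      by (rule expectation_mult_future[OF rT orth, where f = "\<lambda>x. exp (x - (norm q)\<^sup>2 / 2)"])
         (use e\<eta> q1 in auto)
    also have "\<dots> = (\<integral>\<omega>. e \<omega> * \<eta> \<omega> \<partial>M)" by (simp add: q1 mult.commute)
    also have "\<dots> = (\<integral>\<omega>. e \<omega> * \<xi> \<omega> \<partial>M)"
      unfolding \<eta>_def by (rule G.real_cond_exp_intg(2)[OF e\<xi> e_G \<xi>_M])
    also have "\<dots> = S_transform M T X \<iota> \<xi> p"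
      unfolding S_transform_eq by (rule integral_cong_AE) (use ep in auto)
    also have "p = stopped_integrand T \<iota> r (h + 0) - 0"
      unfolding stopped_integrand_def A_def[symmetric] adj p_def by simp
    finally show ?thesis by simp
  qed
  ultimately show "\<xi> \<in> shifted_qce_domain M T X \<iota> r 0"
    unfolding shifted_qce_domain_def using \<xi> by blast
qed

end

theorem theorem3p7:
  fixes M :: "'a measure" and T :: real and X :: "real \<Rightarrow> 'a \<Rightarrow> real"
    and \<iota> :: "(real \<Rightarrow> real) \<Rightarrow> 'h::{real_inner, complete_space}"
  assumes "prob_space M" and "complete_measure M" and "T > 0"
    and "measurable_process M T X"
    and "gaussian_process M T X" and "centered_process M T X"
    and "AE \<omega> in M. X 0 \<omega> = 0"
    and "integrand_space T (covariance M X) \<iota>"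
    and "has_indefinite_wiener_integral T \<iota>"
  shows "\<not> own_martingale M T X \<longleftrightarrow>
    (\<forall>c. \<exists>r\<in>{0..T}. shifted_qce_domain M T X \<iota> r c \<subset> L2X M T X)"
proof -
  interpret prob_space M by fact
  interpret gaussian_setting M T X \<iota>
    by unfold_locales (use assms in auto)
  note ex = \<open>has_indefinite_wiener_integral T \<iota>\<close>
  have sub: "shifted_qce_domain M T X \<iota> r c \<subseteq> L2X M T X" for r c
    unfolding shifted_qce_domain_def by auto
  show ?thesis
  proof
    assume not_mart: "\<not> own_martingale M T X"
    show "\<forall>c. \<exists>r\<in>{0..T}. shifted_qce_domain M T X \<iota> r c \<subset> L2X M T X"
    proof (rule ccontr)
      assume "\<not> ?thesis"
      then obtain c where full: "\<And>r. r \<in> {0..T} \<Longrightarrow> L2X M T X \<subseteq> shifted_qce_domain M T X \<iota> r c"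
        using sub by blast
      have "inner (\<e> t - \<e> s) (\<e> u) = 0" if "0 \<le> u" "u \<le> s" "s \<le> t" "t \<le> T" for s t u
      proof (rule orthogonal_of_contraction[OF is_restriction_op_restriction_op[OF ex] restriction_contraction[OF ex _ full]])
      qed (use that in auto)
      then show False using martingale_of_orthogonal not_mart by blast
    qed
  next
    assume "\<forall>c. \<exists>r\<in>{0..T}. shifted_qce_domain M T X \<iota> r c \<subset> L2X M T X"
    then show "\<not> own_martingale M T X" using qce_domain_of_martingale[OF ex] by blast
  qed
qed

end
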